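(* Let $\varphi\in\mathbb S^-$ be a Musielak--Orlicz function on $\Omega\times[0,\infty)$ which is of uniformly lower type $p_\varphi^-$ for some $p_\varphi^-\in(0,\infty)$ and of uniformly upper type $p_\varphi^+$ for some $p_\varphi^+\in(0,\infty)$. If $q\in(\max\{p_\varphi^+,1\},\infty]$ and the stochastic basis $\{\mathcal F_n\}_{n\in\mathbb Z_+}$ is regular, then $$WH_\varphi^S(\Omega)=WH_{\rm at}^{\varphi,q,S}(\Omega)\qquad\text{and}\qquad WH_\varphi^M(\Omega)=WH_{\rm at}^{\varphi,q,M}(\Omega)$$ with equivalent quasi-norms (i.e. in each case the two sets of martingales coincide and the two quasi-norms are comparable up to positive constants independent of the martingale).
   Context: Setting. $(\Omega,\mathcal F,\mathbb P)$ is a probability space, $\{\mathcal F_n\}_{n\in\mathbb Z_+}$ ($\mathbb Z_+=\{0,1,2,\dots\}$, $\mathbb N=\{1,2,\dots\}$) is an increasing sequence of sub-$\sigma$-algebras of $\mathcal F$, and $\mathbb E_n$ is the conditional expectation given $\mathcal F_n$. The stochastic basis $\{\mathcal F_n\}$ is regular if there is a constant $R>0$ such that $f_n\le Rf_{n-1}$ a.e. for all $n\in\mathbb N$ and every nonnegative martingale $(f_n)_{n\in\mathbb Z_+}$. Musielak--Orlicz functions. $\varphi:\Omega\times[0,\infty)\to[0,\infty)$ is a Musielak--Orlicz function if $\varphi(\cdot,t)$ is measurable for each $t\in[0,\infty)$ and, for each $x\in\Omega$, $\varphi(x,\cdot)$ is non-decreasing, $\varphi(x,0)=0$, $\varphi(x,t)>0$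 for $t\in(0,\infty)$, and $\lim_{t\to\infty}\varphi(x,t)=\infty$. It is of uniformly lower (resp. upper) type $p\in(0,\infty)$ if there is a constant $C_{(p)}>0$ with $\varphi(x,st)\le C_{(p)}s^p\varphi(x,t)$ for all $x\in\Omega$, $t\in[0,\infty)$ and $s\in(0,1)$ (resp. $s\in[1,\infty)$). Standing assumption: $\int_\Omega\varphi(x,t)\,d\mathbb P(x)<\infty$ for every $t\in(0,\infty)$. Put $\varphi_n(\cdot,t):=\mathbb E_n(\varphi(\cdot,t))$. $\varphi\in\mathbb S^-$ means there is a constant $K>0$ with $\frac1K\varphi_{n-1}(x,t)\le\varphi_n(x,t)$ for all $n\in\mathbb N$, $t\in(0,\infty)$ and almost every $x\in\Omega$. For measurable $E\subseteq\Omega$, $\varphi(E,t):=\int_E\varphi(x,t)\,d\mathbb P(x)$. Weak space. $\|f\|_{WL_\varphi(\Omega)}:=\inf\{\lambda\in(0,\infty):\ \sup_{\alpha\in(0,\infty)}\varphi(\{x\in\Omega:|f(x)|>\alpha\},\alpha/\lambda)\le1\}$, and $WL_\varphi(\Omega)$ is the set of measurable $f$ with $\|f\|_{WL_\varphi(\Omega)}<\infty$. Also $\|f\|_{L^\varphi(\Omega)}:=\inf\{\lambda\in(0,\infty):\int_\Omega\varphi(x,|f(x)|/\lambda)\,d\mathbb P(x)\le1\}$. Martingales. $\mathcal M$ is the set of martingales $f=(f_n)_{n\in\mathbb Z_+}$ with respect to $\{\mathcal F_n\}$ with $f_0=0$; $d_nf:=f_n-f_{n-1}$ for $n\in\mathbb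 N$; $M(f):=\sup_{n\in\mathbb Z_+}|f_n|$; $S(f):=(\sum_{i=1}^\infty|d_if|^2)^{1/2}$. $WH_\varphi^S(\Omega)$ (resp. $WH_\varphi^M(\Omega)$) is the set of $f\in\mathcal M$ with $\|f\|_{WH_\varphi^S(\Omega)}:=\|S(f)\|_{WL_\varphi(\Omega)}<\infty$ (resp. $\|f\|_{WH_\varphi^M(\Omega)}:=\|M(f)\|_{WL_\varphi(\Omega)}<\infty$). Atoms. For a stopping time $\nu$ (with values in $\mathbb Z_+\cup\{\infty\}$) let $B_\nu:=\{x\in\Omega:\nu(x)<\infty\}$. For measurable $B\subseteq\Omega$, $\|g\|_{L_\varphi^q(B)}:=\sup_{t\in(0,\infty)}\left[\frac1{\varphi(B,t)}\int_\Omega|g(x)|^q\varphi(x,t)\,d\mathbb P(x)\right]^{1/q}$ if $q\in[1,\infty)$, and $\|g\|_{L_\varphi^\infty(B)}:=\|g\|_{L^\infty(\Omega)}$. For $q\in(1,\infty]$, an (integrable) measurable function $a$ is a $(\varphi,q)_S$-atom (resp. $(\varphi,q)_M$-atom) if there is a stopping time $\nu$ (the stopping time associated with $a$) such that (i) for every $n\in\mathbb Z_+$, $a_n:=\mathbb E_n a=0$ on $\{\nu\ge n\}$; (ii) $\|S(a)\|_{L_\varphi^q(B_\nu)}\le\|\mathbf 1_{B_\nu}\|_{L^\varphi(\Omega)}^{-1}$ (resp. $\|M(a)\|_{L_\varphi^q(B_\nu)}\le\|\mathbf 1_{B_\nu}\|_{L^\varphi(\Omega)}^{-1}$), where $S(a),M(a)$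 are those of the martingale $(a_n)_n$. If $\mathbb P(B_\nu)=0$, then all $a_n=0$ a.e. and (ii) is regarded as satisfied. Atomic spaces. Fix a constant $\widetilde C\in(0,\infty)$ (independent of $f$; the equivalence constants may depend on it). $WH_{\rm at}^{\varphi,q,S}(\Omega)$ (resp. $WH_{\rm at}^{\varphi,q,M}(\Omega)$) is the set of $f\in\mathcal M$ for which there is a sequence of $(\varphi,q)_S$-atoms (resp. $(\varphi,q)_M$-atoms) $\{a^k\}_{k\in\mathbb Z}$ with associated stopping times $\{\nu^k\}_{k\in\mathbb Z}$ such that, for every $n\in\mathbb Z_+$, $f_n=\sum_{k\in\mathbb Z}\mu^ka_n^k$ $\mathbb P$-a.e., where $\mu^k:=\widetilde C2^k\|\mathbf 1_{B_{\nu^k}}\|_{L^\varphi(\Omega)}$, and whose quasi-norm, defined as $\inf\left\{\inf\left\{\lambda\in(0,\infty):\sup_{k\in\mathbb Z}\varphi(B_{\nu^k},2^k/\lambda)\le1\right\}\right\}$ with the outer infimum over all such decompositions of $f$, is finite. *)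

theory Defs
  imports "HOL-Probability.Probability" "HOL-Library.Extended_Nat"
begin

text \<open>
  All quasi-norms take values in \<^typ>\<open>ennreal\<close>; since \<open>Inf {} = \<infinity>\<close> there, an empty set of
  admissible scalars gives the value \<open>\<infinity>\<close>. The functions \<open>S(f)\<close> and \<open>M(f)\<close> may be infinite at some
  points and are therefore \<^typ>\<open>ennreal\<close>-valued as well.
\<close>

text \<open>Power with a real exponent \<open>r > 0\<close>, with \<open>\<infinity> ^ r = \<infinity>\<close>.\<close>

definition ennreal_rpow :: "ennreal \<Rightarrow> real \<Rightarrow> ennreal" where
  "ennreal_rpow u r = (if u = \<infinity> then \<infinity> else ennreal (enn2real u powr r))"


section \<open>Martingales and the stochastic basis\<close>

definition martingale :: "'a measure \<Rightarrow> (nat \<Rightarrow> 'a measure) \<Rightarrow> (nat \<Rightarrow> 'a \<Rightarrow> real) \<Rightarrow> bool" where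
  "martingale M F f \<longleftrightarrow>
     (\<forall>n. integrable M (f n) \<and> f n \<in> borel_measurable (F n)) \<and>
     (\<forall>m n. m \<le> n \<longrightarrow> (AE x in M. real_cond_exp M (F m) (f n) x = f m x))"

definition regular_basis :: "'a measure \<Rightarrow> (nat \<Rightarrow> 'a measure) \<Rightarrow> bool" where
  "regular_basis M F \<longleftrightarrow>
     (\<exists>R>0. \<forall>f. martingale M F f \<and> (\<forall>n. AE x in M. 0 \<le> f n x) \<longrightarrow>
        (\<forall>n\<ge>1. AE x in M. f n x \<le> R * f (n - 1) x))"

definition null_martingales :: "'a measure \<Rightarrow> (nat \<Rightarrow> 'a measure) \<Rightarrow> (nat \<Rightarrow> 'a \<Rightarrow> real) set" where
  "null_martingales M F = {f. martingale M F f \<and> (AE x in M. f 0 x = 0)}"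

definition mdiff :: "(nat \<Rightarrow> 'a \<Rightarrow> real) \<Rightarrow> nat \<Rightarrow> 'a \<Rightarrow> real" where
  "mdiff f n x = f n x - f (n - 1) x"

definition maximal_fun :: "(nat \<Rightarrow> 'a \<Rightarrow> real) \<Rightarrow> 'a \<Rightarrow> ennreal" where
  "maximal_fun f x = (SUP n. ennreal \<bar>f n x\<bar>)"

text \<open>The series runs over the martingale differences of index \<open>Suc i\<close>, that is over \<open>1, 2, \<dots>\<close>.\<close>

definition square_fun :: "(nat \<Rightarrow> 'a \<Rightarrow> real) \<Rightarrow> 'a \<Rightarrow> ennreal" where
  "square_fun f x = ennreal_rpow (\<Sum>i. ennreal (\<bar>mdiff f (Suc i) x\<bar>\<^sup>2)) (1 / 2)"


section \<open>Musielak--Orlicz functions\<close>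

text \<open>Only the values of \<open>\<phi> x t\<close> for \<open>x \<in> space M\<close> and \<open>t \<ge> 0\<close> are meaningful.\<close>

definition musielak_orlicz :: "'a measure \<Rightarrow> ('a \<Rightarrow> real \<Rightarrow> real) \<Rightarrow> bool" where
  "musielak_orlicz M \<phi> \<longleftrightarrow>
     (\<forall>t\<ge>0. (\<lambda>x. \<phi> x t) \<in> borel_measurable M) \<and>
     (\<forall>x\<in>space M. (\<forall>t\<ge>0. 0 \<le> \<phi> x t) \<and> mono_on {0..} (\<phi> x) \<and> \<phi> x 0 = 0 \<and>
        (\<forall>t>0. 0 < \<phi> x t) \<and> filterlim (\<phi> x) at_top at_top)"

definition uniformly_lower_type :: "'a measure \<Rightarrow> ('a \<Rightarrow> real \<Rightarrow> real) \<Rightarrow> real \<Rightarrow> bool" where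
  "uniformly_lower_type M \<phi> p \<longleftrightarrow>
     (\<exists>C>0. \<forall>x\<in>space M. \<forall>t\<ge>0. \<forall>s\<in>{0<..<1}. \<phi> x (s * t) \<le> C * s powr p * \<phi> x t)"

definition uniformly_upper_type :: "'a measure \<Rightarrow> ('a \<Rightarrow> real \<Rightarrow> real) \<Rightarrow> real \<Rightarrow> bool" where
  "uniformly_upper_type M \<phi> p \<longleftrightarrow>
     (\<exists>C>0. \<forall>x\<in>space M. \<forall>t\<ge>0. \<forall>s\<in>{1..}. \<phi> x (s * t) \<le> C * s powr p * \<phi> x t)"

definition cond_phi ::
    "'a measure \<Rightarrow> (nat \<Rightarrow> 'a measure) \<Rightarrow> ('a \<Rightarrow> real \<Rightarrow> real) \<Rightarrow> nat \<Rightarrow> 'a \<Rightarrow> real \<Rightarrow> real" where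
  "cond_phi M F \<phi> n x t = real_cond_exp M (F n) (\<lambda>y. \<phi> y t) x"

text \<open>
  The exceptional null set may depend on \<open>t\<close>: for each \<open>t\<close> the conditional expectation is
  determined only up to a null set.
\<close>

definition S_minus :: "'a measure \<Rightarrow> (nat \<Rightarrow> 'a measure) \<Rightarrow> ('a \<Rightarrow> real \<Rightarrow> real) \<Rightarrow> bool" where
  "S_minus M F \<phi> \<longleftrightarrow>
     (\<exists>K>0. \<forall>n\<ge>1. \<forall>t>0. AE x in M. 1 / K * cond_phi M F \<phi> (n - 1) x t \<le> cond_phi M F \<phi> n x t)"

definition phi_measure :: "'a measure \<Rightarrow> ('a \<Rightarrow> real \<Rightarrow> real) \<Rightarrow> 'a set \<Rightarrow> real \<Rightarrow> ennreal" where
  "phi_measure M \<phi> E t = (\<integral>\<^sup>+x\<in>E. ennreal (\<phi> x t) \<partial>M)"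


section \<open>Quasi-norms and weak Hardy spaces\<close>

definition L_phi_norm :: "'a measure \<Rightarrow> ('a \<Rightarrow> real \<Rightarrow> real) \<Rightarrow> ('a \<Rightarrow> real) \<Rightarrow> ennreal" where
  "L_phi_norm M \<phi> f =
     Inf {ennreal r | r. 0 < r \<and> (\<integral>\<^sup>+x. ennreal (\<phi> x (\<bar>f x\<bar> / r)) \<partial>M) \<le> 1}"

text \<open>The argument \<open>g\<close> plays the role of \<open>\<bar>f\<bar>\<close>.\<close>

definition WL_norm :: "'a measure \<Rightarrow> ('a \<Rightarrow> real \<Rightarrow> real) \<Rightarrow> ('a \<Rightarrow> ennreal) \<Rightarrow> ennreal" where
  "WL_norm M \<phi> g =
     Inf {ennreal r | r. 0 < r \<and>
       (SUP \<alpha>\<in>{0<..}. phi_measure M \<phi> {x \<in> space M. ennreal \<alpha> < g x} (\<alpha> / r)) \<le> 1}"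

text \<open>
  Below, the operator \<open>T\<close> stands for \<^const>\<open>square_fun\<close> or \<^const>\<open>maximal_fun\<close>.
\<close>

definition WH_norm ::
    "((nat \<Rightarrow> 'a \<Rightarrow> real) \<Rightarrow> 'a \<Rightarrow> ennreal) \<Rightarrow> 'a measure \<Rightarrow> ('a \<Rightarrow> real \<Rightarrow> real) \<Rightarrow>
     (nat \<Rightarrow> 'a \<Rightarrow> real) \<Rightarrow> ennreal" where
  "WH_norm T M \<phi> f = WL_norm M \<phi> (T f)"

definition WH ::
    "((nat \<Rightarrow> 'a \<Rightarrow> real) \<Rightarrow> 'a \<Rightarrow> ennreal) \<Rightarrow> 'a measure \<Rightarrow> (nat \<Rightarrow> 'a measure) \<Rightarrow>
     ('a \<Rightarrow> real \<Rightarrow> real) \<Rightarrow> (nat \<Rightarrow> 'a \<Rightarrow> real) set" where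
  "WH T M F \<phi> = {f \<in> null_martingales M F. WH_norm T M \<phi> f < \<infinity>}"


section \<open>Atoms and atomic spaces\<close>

text \<open>
  A stopping time here takes values in \<open>{0, 1, \<dots>, \<infinity>}\<close>. The notion \<^const>\<open>stopping_time\<close> wants
  the filtration to be indexed by the same type; at the index \<open>\<infinity>\<close> its condition is void.
\<close>

definition ext_stopping_time ::
    "'a measure \<Rightarrow> (nat \<Rightarrow> 'a measure) \<Rightarrow> ('a \<Rightarrow> enat) \<Rightarrow> bool" where
  "ext_stopping_time M F \<nu> \<longleftrightarrow> stopping_time (\<lambda>t. case t of enat n \<Rightarrow> F n | \<infinity> \<Rightarrow> M) \<nu>"

definition hit_set :: "'a measure \<Rightarrow> ('a \<Rightarrow> enat) \<Rightarrow> 'a set" where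
  "hit_set M \<nu> = {x \<in> space M. \<nu> x < \<infinity>}"

definition L_phi_q_norm ::
    "'a measure \<Rightarrow> ('a \<Rightarrow> real \<Rightarrow> real) \<Rightarrow> ennreal \<Rightarrow> 'a set \<Rightarrow> ('a \<Rightarrow> ennreal) \<Rightarrow> ennreal" where
  "L_phi_q_norm M \<phi> q B g =
     (if q = \<infinity> then esssup M g
      else SUP t\<in>{0<..}. ennreal_rpow
        (1 / phi_measure M \<phi> B t * (\<integral>\<^sup>+x. ennreal_rpow (g x) (enn2real q) * ennreal (\<phi> x t) \<partial>M))
        (1 / enn2real q))"

definition cond_seq :: "'a measure \<Rightarrow> (nat \<Rightarrow> 'a measure) \<Rightarrow> ('a \<Rightarrow> real) \<Rightarrow> nat \<Rightarrow> 'a \<Rightarrow> real" where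
  "cond_seq M F a n = real_cond_exp M (F n) a"

definition is_atom ::
    "((nat \<Rightarrow> 'a \<Rightarrow> real) \<Rightarrow> 'a \<Rightarrow> ennreal) \<Rightarrow> 'a measure \<Rightarrow> (nat \<Rightarrow> 'a measure) \<Rightarrow>
     ('a \<Rightarrow> real \<Rightarrow> real) \<Rightarrow> ennreal \<Rightarrow> ('a \<Rightarrow> real) \<Rightarrow> ('a \<Rightarrow> enat) \<Rightarrow> bool" where
  "is_atom T M F \<phi> q a \<nu> \<longleftrightarrow>
     integrable M a \<and> ext_stopping_time M F \<nu> \<and>
     (\<forall>n. AE x in M. enat n \<le> \<nu> x \<longrightarrow> cond_seq M F a n x = 0) \<and>
     (emeasure M (hit_set M \<nu>) = 0 \<or>
      L_phi_q_norm M \<phi> q (hit_set M \<nu>) (T (cond_seq M F a))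
        \<le> inverse (L_phi_norm M \<phi> (indicator (hit_set M \<nu>))))"

text \<open>
  \<open>c\<close> is the constant in the coefficients \<open>\<mu>\<^sup>k\<close>. The norm of the indicator function is finite
  whenever \<open>\<phi>\<close> is of some uniformly lower type and the functions \<open>\<lambda>x. \<phi> x t\<close> are integrable, so
  that \<^const>\<open>enn2real\<close> loses nothing.
\<close>

definition atom_coeff ::
    "'a measure \<Rightarrow> ('a \<Rightarrow> real \<Rightarrow> real) \<Rightarrow> real \<Rightarrow> (int \<Rightarrow> 'a \<Rightarrow> enat) \<Rightarrow> int \<Rightarrow> real" where
  "atom_coeff M \<phi> c \<nu> k =
     c * 2 powi k * enn2real (L_phi_norm M \<phi> (indicator (hit_set M (\<nu> k))))"

text \<open>
  The series over all integers is read as an unconditional sum.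
\<close>

definition atomic_decomps ::
    "((nat \<Rightarrow> 'a \<Rightarrow> real) \<Rightarrow> 'a \<Rightarrow> ennreal) \<Rightarrow> 'a measure \<Rightarrow> (nat \<Rightarrow> 'a measure) \<Rightarrow>
     ('a \<Rightarrow> real \<Rightarrow> real) \<Rightarrow> ennreal \<Rightarrow> real \<Rightarrow> (nat \<Rightarrow> 'a \<Rightarrow> real) \<Rightarrow>
     ((int \<Rightarrow> 'a \<Rightarrow> real) \<times> (int \<Rightarrow> 'a \<Rightarrow> enat)) set" where
  "atomic_decomps T M F \<phi> q c f =
     {(a, \<nu>). (\<forall>k. is_atom T M F \<phi> q (a k) (\<nu> k)) \<and>
        (\<forall>n. AE x in M.
           ((\<lambda>k. atom_coeff M \<phi> c \<nu> k * cond_seq M F (a k) n x) has_sum f n x) UNIV)}"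

definition WH_at_norm ::
    "((nat \<Rightarrow> 'a \<Rightarrow> real) \<Rightarrow> 'a \<Rightarrow> ennreal) \<Rightarrow> 'a measure \<Rightarrow> (nat \<Rightarrow> 'a measure) \<Rightarrow>
     ('a \<Rightarrow> real \<Rightarrow> real) \<Rightarrow> ennreal \<Rightarrow> real \<Rightarrow> (nat \<Rightarrow> 'a \<Rightarrow> real) \<Rightarrow> ennreal" where
  "WH_at_norm T M F \<phi> q c f =
     (INF (a, \<nu>) \<in> atomic_decomps T M F \<phi> q c f.
        Inf {ennreal r | r. 0 < r \<and>
          (SUP k. phi_measure M \<phi> (hit_set M (\<nu> k)) (2 powi k / r)) \<le> 1})"

definition WH_at ::
    "((nat \<Rightarrow> 'a \<Rightarrow> real) \<Rightarrow> 'a \<Rightarrow> ennreal) \<Rightarrow> 'a measure \<Rightarrow> (nat \<Rightarrow> 'a measure) \<Rightarrow>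
     ('a \<Rightarrow> real \<Rightarrow> real) \<Rightarrow> ennreal \<Rightarrow> real \<Rightarrow> (nat \<Rightarrow> 'a \<Rightarrow> real) set" where
  "WH_at T M F \<phi> q c =
     {f \<in> null_martingales M F.
        atomic_decomps T M F \<phi> q c f \<noteq> {} \<and> WH_at_norm T M F \<phi> q c f < \<infinity>}"

definition equivalent_on :: "'b set \<Rightarrow> ('b \<Rightarrow> ennreal) \<Rightarrow> ('b \<Rightarrow> ennreal) \<Rightarrow> bool" where
  "equivalent_on A N N' \<longleftrightarrow>
     (\<exists>c>0. \<exists>C>0. \<forall>f\<in>A. ennreal c * N f \<le> N' f \<and> N' f \<le> ennreal C * N f)"

end

theory Submission
  imports Defs
begin

text \<open>
  Both operators have the form \<open>T f = sup\<^sub>n N\<^sub>n f\<close>, where \<open>N\<^sub>n\<close> is a seminorm depending on the first \<open>n\<close> terms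
  only; this covers the two equivalences at once.

  Given \<open>f\<close> in the weak Hardy space, let \<open>\<nu>\<^sup>k\<close> be the first time \<open>n\<close> at which the conditional
  probability of \<open>N\<^bsub>n+1\<^esub> f > c 2\<^sup>k / 3\<close> given \<open>\<F>\<^sub>n\<close> is at least \<open>1 / R\<close>. By regularity \<open>f\<close> stopped at \<open>\<nu>\<^sup>k\<close>
  satisfies \<open>T f \<le> c 2\<^sup>k / 3\<close>, and the condition \<open>S\<^sup>-\<close> gives
  \<open>\<phi>(B\<^bsub>\<nu>\<^sup>k\<^esub>, t) \<le> R K \<phi>({T f > c 2\<^sup>k / 3}, t)\<close>. The difference of \<open>f\<close> stopped at \<open>\<nu>\<^sup>k\<^sup>+\<^sup>1\<close> and
  at \<open>\<nu>\<^sup>k\<close> is bounded in \<open>L\<^sup>2\<close>, hence closed by an integrable function, which is a multiple of an atom.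

  Conversely, split an atomic series at the index \<open>K\<close> with \<open>2\<^sup>K \<le> \<alpha> < 2\<^sup>K\<^sup>+\<^sup>1\<close>: the atoms with \<open>k \<ge> K\<close> are
  controlled through their supports and the lower type, those with \<open>k < K\<close> through Chebyshev's
  inequality and the upper type, which is where \<open>q > pp\<close> enters.
\<close>

section \<open>Maximal and square functions as suprema of seminorms\<close>

text \<open>The first time at which \<open>N n f\<close> exceeds a level would not do: the value
  there has already overshot, with no bound in terms of the level, so the stopped martingale need
  not be bounded. The alarm must therefore be decided from \<open>F n\<close> alone. Regularity,
  applied to the martingale of conditional probabilities of an event A in \<open>F (Suc n)\<close>,
  gives 1_A \<le> R P(A | \<open>F n\<close>) a.e., so A cannot occur where this probability is
  below 1/R. The price is false alarms; but each alarm is justified with conditional probability at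
  least 1/R, and the comparison of consecutive conditional expectations of \<phi> in the condition
  S^- carries this over to \<phi>-measure. The fraction c/3 comes from 2^k + 2^(k+1) = 3 * 2^k: a
  difference of two consecutive stopped martingales is then bounded by exactly c 2^k, the
  coefficient of the k-th atom before normalisation. Atoms built this way are bounded, so they serve
  all q at once. In both directions the estimates of \<phi>-measures carry a factor C. Lower type
  removes it: shrinking the argument by s costs at most \<open>Cl * s powr pm\<close>, which is
  below 1/C for small s.\<close>

text \<open>
  The first alternative of \<open>N_L2\<close> holds for \<open>M\<close>, the second one for \<open>S\<close>. Either way a bound on
  \<open>N n g\<close> bounds \<open>g n\<close> in \<open>L\<^sup>2\<close> for a martingale \<open>g\<close>, in the second case by orthogonality of increments.
\<close>

locale martingale_operator =
  fixes T :: "(nat \<Rightarrow> 'a \<Rightarrow> real) \<Rightarrow> 'a \<Rightarrow> ennreal" and N :: "nat \<Rightarrow> (nat \<Rightarrow> real) \<Rightarrow> real"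
  assumes T_eq_SUP: "T f x = (SUP n. ennreal (N n (\<lambda>i. f i x)))"
    and N_nonneg: "0 \<le> N n u"
    and N_0: "N 0 u \<le> \<bar>u 0\<bar>"
    and N_add: "N n (\<lambda>i. u i + v i) \<le> N n u + N n v"
    and N_scale: "N n (\<lambda>i. r * u i) = \<bar>r\<bar> * N n u"
    and N_measurable: "(\<And>i. i \<le> n \<Longrightarrow> f i \<in> borel_measurable (A :: 'a measure)) \<Longrightarrow>
      (\<lambda>x. N n (\<lambda>i. f i x)) \<in> borel_measurable A"
    and N_stop: "N n (\<lambda>i. u (min i m)) \<le> N m u"
    and N_increment: "\<bar>u (Suc n) - u n\<bar> \<le> 2 * N (Suc n) u"
    and N_le_sum: "N n u \<le> (\<Sum>i\<le>n. 2 * \<bar>u i\<bar>)"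
    and N_L2: "(\<forall>n u. (u n)\<^sup>2 \<le> (N n u)\<^sup>2) \<or> (\<forall>n u. (\<Sum>i<n. (u (Suc i) - u i)\<^sup>2) \<le> (N n u)\<^sup>2)"
begin

lemma N_diff: "N n (\<lambda>i. u i - v i) \<le> N n u + N n v"
  using N_add[of n u "\<lambda>i. -1 * v i"] N_scale[of n "-1" v] by simp

lemma N_sum: "finite K \<Longrightarrow> N n (\<lambda>i. \<Sum>k\<in>K. u k i) \<le> (\<Sum>k\<in>K. N n (u k))"
proof (induction K rule: finite_induct)
  case empty
  then show ?case using N_scale[of n 0 "\<lambda>_. 0"] by simp
next
  case (insert k K)
  then show ?case using N_add[of n "u k" "\<lambda>i. \<Sum>k\<in>K. u k i"] by simp
qed

text \<open>\<open>N n\<close> sees only finitely many coordinates and is dominated by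
  \<open>N_le_sum\<close>, so pointwise convergence makes \<open>N n\<close> of the remainder tend
  to 0; the finite part is handled by subadditivity.\<close>

lemma N_has_sum_le:
  assumes sums: "\<And>i. i \<le> n \<Longrightarrow> ((\<lambda>k. u k i) has_sum v i) UNIV"
    and le: "\<And>K. finite K \<Longrightarrow> (\<Sum>k\<in>K. N n (u k)) \<le> C"
  shows "N n v \<le> C"
proof -
  let ?G = "finite_subsets_at_top (UNIV :: 'b set)"
  have "((\<lambda>K. C + (\<Sum>i\<le>n. 2 * \<bar>v i - (\<Sum>k\<in>K. u k i)\<bar>)) \<longlongrightarrow> C + (\<Sum>i\<le>n. 2 * \<bar>v i - v i\<bar>)) ?G"
    using sums by (intro tendsto_intros) (auto simp: has_sum_def)
  moreover have "\<forall>\<^sub>F K in ?G. N n v \<le> C + (\<Sum>i\<le>n. 2 * \<bar>v i - (\<Sum>k\<in>K. u k i)\<bar>)"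
  proof (rule eventually_finite_subsets_at_top_weakI)
    fix K :: "'b set" assume K: "finite K"
    have "N n v = N n (\<lambda>i. (\<Sum>k\<in>K. u k i) + (v i - (\<Sum>k\<in>K. u k i)))" by simp
    also have "\<dots> \<le> N n (\<lambda>i. \<Sum>k\<in>K. u k i) + N n (\<lambda>i. v i - (\<Sum>k\<in>K. u k i))" by (rule N_add)
    also have "\<dots> \<le> C + (\<Sum>i\<le>n. 2 * \<bar>v i - (\<Sum>k\<in>K. u k i)\<bar>)"
      by (intro add_mono N_le_sum order_trans[OF N_sum[OF K] le[OF K]])
    finally show "N n v \<le> C + (\<Sum>i\<le>n. 2 * \<bar>v i - (\<Sum>k\<in>K. u k i)\<bar>)" .
  qed
  ultimately have "N n v \<le> C + (\<Sum>i\<le>n. 2 * \<bar>v i - v i\<bar>)"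
    by (intro tendsto_lowerbound[of _ _ ?G]) auto
  then show ?thesis by simp
qed

lemma N_le_T: "ennreal (N n (\<lambda>i. f i x)) \<le> T f x"
  unfolding T_eq_SUP by (rule SUP_upper) simp

lemma T_leI: "(\<And>n. N n (\<lambda>i. f i x) \<le> C) \<Longrightarrow> T f x \<le> ennreal C"
  unfolding T_eq_SUP by (intro SUP_least ennreal_leI)

lemma T_eq_0: "(\<And>n. f n x = 0) \<Longrightarrow> T f x = 0"
  unfolding T_eq_SUP using N_scale[of _ 0 "\<lambda>_. 0"] by (simp add: bot_ennreal)

lemma T_measurable:
  assumes "\<And>n. f n \<in> borel_measurable A"
  shows "T f \<in> borel_measurable A"
proof -
  have [measurable]: "(\<lambda>x. N n (\<lambda>i. f i x)) \<in> borel_measurable A" for n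
    by (rule N_measurable) (rule assms)
  have "T f = (\<lambda>x. SUP n. ennreal (N n (\<lambda>i. f i x)))" by (rule ext) (rule T_eq_SUP)
  then show ?thesis by simp
qed

lemma less_T_iff: "0 \<le> \<alpha> \<Longrightarrow> ennreal \<alpha> < T f x \<longleftrightarrow> (\<exists>n. \<alpha> < N n (\<lambda>i. f i x))"
  unfolding T_eq_SUP less_SUP_iff by (simp add: ennreal_less_iff)

end

lemma martingale_operator_maximal_fun:
  "martingale_operator (maximal_fun :: (nat \<Rightarrow> 'a \<Rightarrow> real) \<Rightarrow> _) (\<lambda>n u. Max ((\<lambda>i. \<bar>u i\<bar>) ` {..n}))"
proof
  fix n m :: nat and u v :: "nat \<Rightarrow> real" and r :: real
  have upper: "\<bar>u i\<bar> \<le> Max ((\<lambda>i. \<bar>u i\<bar>) ` {..n})" if "i \<le> n" for i n and u :: "nat \<Rightarrow> real"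
    using that by (intro Max_ge) auto
  show nonneg: "0 \<le> Max ((\<lambda>i. \<bar>u i\<bar>) ` {..n})"
    using upper[of 0 n u] abs_ge_zero[of "u 0"] by linarith
  show "Max ((\<lambda>i. \<bar>u i\<bar>) ` {..0}) \<le> \<bar>u 0\<bar>" by simp
  show "Max ((\<lambda>i. \<bar>u i + v i\<bar>) ` {..n}) \<le> Max ((\<lambda>i. \<bar>u i\<bar>) ` {..n}) + Max ((\<lambda>i. \<bar>v i\<bar>) ` {..n})"
  proof (intro Max.boundedI)
    fix a assume "a \<in> (\<lambda>i. \<bar>u i + v i\<bar>) ` {..n}"
    then obtain i where i: "i \<le> n" "a = \<bar>u i + v i\<bar>" by auto
    then show "a \<le> Max ((\<lambda>i. \<bar>u i\<bar>) ` {..n}) + Max ((\<lambda>i. \<bar>v i\<bar>) ` {..n})"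
      using upper[of i n u] upper[of i n v] abs_triangle_ineq[of "u i" "v i"] by linarith
  qed auto
  have "Max ((\<lambda>i. \<bar>r * u i\<bar>) ` {..n}) = Max ((\<lambda>y. \<bar>r\<bar> * y) ` (\<lambda>i. \<bar>u i\<bar>) ` {..n})"
    by (simp add: image_image abs_mult)
  also have "\<dots> = \<bar>r\<bar> * Max ((\<lambda>i. \<bar>u i\<bar>) ` {..n})"
    by (rule mono_Max_commute[symmetric]) (auto simp: mono_def mult_left_mono)
  finally show "Max ((\<lambda>i. \<bar>r * u i\<bar>) ` {..n}) = \<bar>r\<bar> * Max ((\<lambda>i. \<bar>u i\<bar>) ` {..n})" .
  show "Max ((\<lambda>i. \<bar>u (min i m)\<bar>) ` {..n}) \<le> Max ((\<lambda>i. \<bar>u i\<bar>) ` {..m})"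
    by (intro Max_mono) auto
  show "\<bar>u (Suc n) - u n\<bar> \<le> 2 * Max ((\<lambda>i. \<bar>u i\<bar>) ` {..Suc n})"
    using upper[of n "Suc n" u] upper[of "Suc n" "Suc n" u] abs_triangle_ineq4[of "u (Suc n)" "u n"]
    by linarith
  show "Max ((\<lambda>i. \<bar>u i\<bar>) ` {..n}) \<le> (\<Sum>i\<le>n. 2 * \<bar>u i\<bar>)"
  proof (intro Max.boundedI)
    fix a assume "a \<in> (\<lambda>i. \<bar>u i\<bar>) ` {..n}"
    then obtain i where i: "i \<le> n" "a = \<bar>u i\<bar>" by auto
    then show "a \<le> (\<Sum>i\<le>n. 2 * \<bar>u i\<bar>)"
      using member_le_sum[of i "{..n}" "\<lambda>i. 2 * \<bar>u i\<bar>"] by auto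
  qed auto
  show "(\<forall>n (u :: nat \<Rightarrow> real). (u n)\<^sup>2 \<le> (Max ((\<lambda>i. \<bar>u i\<bar>) ` {..n}))\<^sup>2) \<or>
      (\<forall>n (u :: nat \<Rightarrow> real). (\<Sum>i<n. (u (Suc i) - u i)\<^sup>2) \<le> (Max ((\<lambda>i. \<bar>u i\<bar>) ` {..n}))\<^sup>2)"
  proof (intro disjI1 allI)
    fix n and u :: "nat \<Rightarrow> real"
    have "\<bar>u n\<bar>\<^sup>2 \<le> (Max ((\<lambda>i. \<bar>u i\<bar>) ` {..n}))\<^sup>2"
      by (intro power_mono upper) simp_all
    then show "(u n)\<^sup>2 \<le> (Max ((\<lambda>i. \<bar>u i\<bar>) ` {..n}))\<^sup>2" by simp
  qed
next
  fix f :: "nat \<Rightarrow> 'a \<Rightarrow> real" and x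
  show "maximal_fun f x = (SUP n. ennreal (Max ((\<lambda>i. \<bar>f i x\<bar>) ` {..n})))"
    unfolding maximal_fun_def
  proof (intro antisym SUP_least)
    fix n
    have "ennreal \<bar>f n x\<bar> \<le> ennreal (Max ((\<lambda>i. \<bar>f i x\<bar>) ` {..n}))" by (intro ennreal_leI Max_ge) auto
    then show "ennreal \<bar>f n x\<bar> \<le> (SUP n. ennreal (Max ((\<lambda>i. \<bar>f i x\<bar>) ` {..n})))"
      by (rule SUP_upper2[rotated]) simp
    have "Max ((\<lambda>i. \<bar>f i x\<bar>) ` {..n}) \<in> (\<lambda>i. \<bar>f i x\<bar>) ` {..n}" by (intro Max_in) auto
    then obtain i where "Max ((\<lambda>i. \<bar>f i x\<bar>) ` {..n}) = \<bar>f i x\<bar>" by (rule imageE)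
    then show "ennreal (Max ((\<lambda>i. \<bar>f i x\<bar>) ` {..n})) \<le> (SUP n. ennreal \<bar>f n x\<bar>)"
      by (metis SUP_upper UNIV_I)
  qed
next
  fix n and f :: "nat \<Rightarrow> 'a \<Rightarrow> real" and A :: "'a measure"
  assume "\<And>i. i \<le> n \<Longrightarrow> f i \<in> borel_measurable A"
  then show "(\<lambda>x. Max ((\<lambda>i. \<bar>f i x\<bar>) ` {..n})) \<in> borel_measurable A"
    by (intro borel_measurable_Max) auto
qed

lemma martingale_operator_square_fun:
  "martingale_operator (square_fun :: (nat \<Rightarrow> 'a \<Rightarrow> real) \<Rightarrow> _) (\<lambda>n u. L2_set (\<lambda>i. u (Suc i) - u i) {..<n})"
proof
  fix n m :: nat and u v :: "nat \<Rightarrow> real" and r :: real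
  show "0 \<le> L2_set (\<lambda>i. u (Suc i) - u i) {..<n}" by (rule L2_set_nonneg)
  show "L2_set (\<lambda>i. u (Suc i) - u i) {..<0} \<le> \<bar>u 0\<bar>" by simp
  show "L2_set (\<lambda>i. u (Suc i) + v (Suc i) - (u i + v i)) {..<n}
      \<le> L2_set (\<lambda>i. u (Suc i) - u i) {..<n} + L2_set (\<lambda>i. v (Suc i) - v i) {..<n}"
    using L2_set_triangle_ineq[of "\<lambda>i. u (Suc i) - u i" "\<lambda>i. v (Suc i) - v i" "{..<n}"]
    by (simp add: algebra_simps)
  have "(\<Sum>i<n. (r * u (Suc i) - r * u i)\<^sup>2) = r\<^sup>2 * (\<Sum>i<n. (u (Suc i) - u i)\<^sup>2)"
    unfolding sum_distrib_left right_diff_distrib[symmetric] power_mult_distrib ..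
  then show "L2_set (\<lambda>i. r * u (Suc i) - r * u i) {..<n} = \<bar>r\<bar> * L2_set (\<lambda>i. u (Suc i) - u i) {..<n}"
    by (simp add: L2_set_def real_sqrt_mult)
  \<comment> \<open>Increments of the stopped sequence vanish from index m on and agree with those
    of u before.\<close>
  have "(\<Sum>i<n. (u (min (Suc i) m) - u (min i m))\<^sup>2) = (\<Sum>i\<in>{..<n} \<inter> {..<m}. (u (Suc i) - u i)\<^sup>2)"
    by (intro sum.mono_neutral_cong_right) (auto simp: min_def not_less_eq_eq)
  also have "\<dots> \<le> (\<Sum>i<m. (u (Suc i) - u i)\<^sup>2)"
    by (intro sum_mono2) auto
  finally show "L2_set (\<lambda>i. u (min (Suc i) m) - u (min i m)) {..<n} \<le> L2_set (\<lambda>i. u (Suc i) - u i) {..<m}"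
    unfolding L2_set_def by simp
  have "\<bar>u (Suc n) - u n\<bar> \<le> L2_set (\<lambda>i. u (Suc i) - u i) {..<Suc n}"
    using member_le_L2_set[of "{..<Suc n}" n "\<lambda>i. \<bar>u (Suc i) - u i\<bar>"] by (simp add: L2_set_def)
  moreover have "0 \<le> L2_set (\<lambda>i. u (Suc i) - u i) {..<Suc n}" by (rule L2_set_nonneg)
  ultimately show "\<bar>u (Suc n) - u n\<bar> \<le> 2 * L2_set (\<lambda>i. u (Suc i) - u i) {..<Suc n}" by linarith
  have "L2_set (\<lambda>i. u (Suc i) - u i) {..<n} \<le> (\<Sum>i<n. \<bar>u (Suc i) - u i\<bar>)"
    by (rule L2_set_le_sum_abs)
  also have "\<dots> \<le> (\<Sum>i<n. \<bar>u (Suc i)\<bar>) + (\<Sum>i<n. \<bar>u i\<bar>)"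
    unfolding sum.distrib[symmetric] by (intro sum_mono) linarith
  also have "(\<Sum>i<n. \<bar>u (Suc i)\<bar>) \<le> (\<Sum>i\<le>n. \<bar>u i\<bar>)"
    by (simp add: sum.atMost_shift)
  also have "(\<Sum>i<n. \<bar>u i\<bar>) \<le> (\<Sum>i\<le>n. \<bar>u i\<bar>)"
    by (intro sum_mono2) auto
  finally show "L2_set (\<lambda>i. u (Suc i) - u i) {..<n} \<le> (\<Sum>i\<le>n. 2 * \<bar>u i\<bar>)"
    by (simp add: sum_distrib_left[symmetric])
  show "(\<forall>n u. (u n)\<^sup>2 \<le> (L2_set (\<lambda>i. u (Suc i) - u i) {..<n})\<^sup>2) \<or>
      (\<forall>n u. (\<Sum>i<n. (u (Suc i) - u i)\<^sup>2) \<le> (L2_set (\<lambda>i. u (Suc i) - u i) {..<n})\<^sup>2)"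
    unfolding L2_set_def by (simp add: sum_nonneg)
next
  fix f :: "nat \<Rightarrow> 'a \<Rightarrow> real" and x
  define s where "s n = (\<Sum>i<n. (f (Suc i) x - f i x)\<^sup>2)" for n
  have s0: "0 \<le> s n" for n unfolding s_def by (intro sum_nonneg) auto
  have inc: "incseq s" unfolding s_def by (intro incseq_SucI) simp
  have sup: "(\<Sum>i. ennreal (\<bar>mdiff f (Suc i) x\<bar>\<^sup>2)) = (SUP n. ennreal (s n))"
    by (simp add: suminf_eq_SUP s_def mdiff_def)
  have "square_fun f x = (SUP n. ennreal (sqrt (s n)))"
  proof (cases "(SUP n. ennreal (s n)) = top")
    case True
    have "(SUP n. ennreal (sqrt (s n))) = \<infinity>"
      unfolding infinity_ennreal_def
    proof (rule ennreal_SUP_eq_top)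
      fix k :: nat
      have "ennreal (real k ^ 2) < (SUP n. ennreal (s n))" unfolding True by simp
      then obtain n where "real k ^ 2 < s n" by (auto simp: less_SUP_iff ennreal_less_iff)
      then have "real k \<le> sqrt (s n)" by (intro real_le_rsqrt) simp
      then show "\<exists>i\<in>UNIV. of_nat k \<le> ennreal (sqrt (s i))"
        by (metis UNIV_I ennreal_leI ennreal_of_nat_eq_real_of_nat)
    qed
    moreover have "square_fun f x = \<infinity>"
      unfolding square_fun_def sup True ennreal_rpow_def by simp
    ultimately show ?thesis by (rule trans[OF _ sym, rotated])
  next
    case False
    then obtain l where l: "0 \<le> l" "(SUP n. ennreal (s n)) = ennreal l"
      by (cases "SUP n. ennreal (s n)" rule: ennreal_cases) auto
    have "(\<lambda>n. ennreal (s n)) \<longlonglongrightarrow> ennreal l"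
      unfolding l(2)[symmetric] using inc by (intro LIMSEQ_SUP) (auto simp: incseq_def intro: ennreal_leI)
    then have "s \<longlonglongrightarrow> l" using s0 l(1) by (subst (asm) tendsto_ennreal_iff) auto
    then have "(\<lambda>n. ennreal (sqrt (s n))) \<longlonglongrightarrow> ennreal (sqrt l)"
      by (intro tendsto_ennrealI tendsto_real_sqrt)
    moreover have "(\<lambda>n. ennreal (sqrt (s n))) \<longlonglongrightarrow> (SUP n. ennreal (sqrt (s n)))"
      using inc by (intro LIMSEQ_SUP) (auto simp: incseq_def intro: ennreal_leI)
    ultimately have "(SUP n. ennreal (sqrt (s n))) = ennreal (sqrt l)" by (rule LIMSEQ_unique[symmetric])
    then show ?thesis unfolding square_fun_def sup l(2) using l(1)
      by (simp add: ennreal_rpow_def powr_half_sqrt)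
  qed
  then show "square_fun f x = (SUP n. ennreal (L2_set (\<lambda>i. f (Suc i) x - f i x) {..<n}))"
    unfolding L2_set_def s_def .
next
  fix n and f :: "nat \<Rightarrow> 'a \<Rightarrow> real" and A :: "'a measure"
  assume *: "\<And>i. i \<le> n \<Longrightarrow> f i \<in> borel_measurable A"
  have "(\<lambda>x. f (Suc i) x - f i x) \<in> borel_measurable A" if "i < n" for i
    using *[of i] *[of "Suc i"] that by simp
  then show "(\<lambda>x. L2_set (\<lambda>i. f (Suc i) x - f i x) {..<n}) \<in> borel_measurable A"
    unfolding L2_set_def
    by (intro measurable_compose[OF _ borel_measurable_sqrt] borel_measurable_sum borel_measurable_power) auto
qed

section \<open>Martingales on a stochastic basis\<close>

lemma abs_diff_power2_le:
  fixes x y a b :: real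
  assumes "\<bar>x\<bar> \<le> a" "\<bar>y\<bar> \<le> b"
  shows "\<bar>(x - y)\<^sup>2\<bar> \<le> (a + b)\<^sup>2"
proof -
  have "\<bar>x - y\<bar> \<le> a + b" using assms by linarith
  then have "\<bar>x - y\<bar>\<^sup>2 \<le> (a + b)\<^sup>2" by (intro power_mono) auto
  then show ?thesis by simp
qed

locale stochastic_basis = prob_space M for M :: "'a measure" +
  fixes F :: "nat \<Rightarrow> 'a measure"
  assumes filtration_F: "filtration (space M) F"
    and subalgebra_F: "\<And>n. subalgebra M (F n)"
begin

lemma sigma_finite_subalgebra_F: "sigma_finite_subalgebra M (F n)"
proof -
  interpret finite_measure_subalgebra M "F n"
    by unfold_locales (rule subalgebra_F)
  show ?thesis by unfold_locales
qed

interpretation ce: sigma_finite_subalgebra M "F n" for n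
  by (rule sigma_finite_subalgebra_F)

lemma space_F: "space (F n) = space M"
  using subalgebra_F[of n] by (simp add: subalgebra_def)

lemma sets_F_subset: "A \<in> sets (F n) \<Longrightarrow> A \<in> sets M"
  using subalgebra_F[of n] by (auto simp: subalgebra_def)

lemma subalgebra_F_mono: "m \<le> n \<Longrightarrow> subalgebra (F n) (F m)"
  using filtration.sets_F_mono[OF filtration_F] by (simp add: subalgebra_def space_F)

lemma sets_F_mono: "m \<le> n \<Longrightarrow> A \<in> sets (F m) \<Longrightarrow> A \<in> sets (F n)"
  using filtration.sets_F_mono[OF filtration_F, of m n] by auto

lemma measurable_F_mono: "m \<le> n \<Longrightarrow> f \<in> borel_measurable (F m) \<Longrightarrow> f \<in> borel_measurable (F n)"
  using measurable_from_subalg[OF subalgebra_F_mono] by blast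

lemma measurable_F_M: "f \<in> borel_measurable (F n) \<Longrightarrow> f \<in> borel_measurable M"
  using measurable_from_subalg[OF subalgebra_F] by blast

lemma martingale_cond_seq: "integrable M a \<Longrightarrow> martingale M F (cond_seq M F a)"
  unfolding martingale_def cond_seq_def
  by (intro conjI allI impI ce.real_cond_exp_int borel_measurable_cond_exp
      ce.real_cond_exp_nested_subalg subalgebra_F subalgebra_F_mono)

text \<open>Tower property: conditioning on \<open>F n\<close> first turns \<open>f (Suc n)\<close>
  into \<open>f n\<close>, so the one-step identities propagate by induction.\<close>

lemma martingale_SucI:
  assumes int: "\<And>n. integrable M (f n)" and meas: "\<And>n. f n \<in> borel_measurable (F n)"
    and step: "\<And>n. AE x in M. real_cond_exp M (F n) (f (Suc n)) x = f n x"
  shows "martingale M F f"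
  unfolding martingale_def
proof (intro conjI allI impI int meas)
  fix m n :: nat assume "m \<le> n"
  then show "AE x in M. real_cond_exp M (F m) (f n) x = f m x"
  proof (induction n rule: dec_induct)
    case base
    show ?case by (intro ce.real_cond_exp_F_meas int meas)
  next
    case (step n)
    have "AE x in M. real_cond_exp M (F m) (real_cond_exp M (F n) (f (Suc n))) x = real_cond_exp M (F m) (f (Suc n)) x"
      using step by (intro ce.real_cond_exp_nested_subalg subalgebra_F subalgebra_F_mono int) simp
    moreover have "AE x in M. real_cond_exp M (F m) (real_cond_exp M (F n) (f (Suc n))) x = real_cond_exp M (F m) (f n) x"
      using assms(3)[of n] by (rule ce.real_cond_exp_cong) (auto intro: measurable_F_M meas)
    ultimately show ?case using step.IH by eventually_elim simp
  qed
qed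

lemma
  assumes "martingale M F f"
  shows martingale_integrable: "integrable M (f n)"
    and martingale_adapted: "f n \<in> borel_measurable (F n)"
    and martingale_measurable: "f n \<in> borel_measurable M"
    and martingale_cond_exp: "m \<le> n \<Longrightarrow> AE x in M. real_cond_exp M (F m) (f n) x = f m x"
  using assms by (auto simp: martingale_def)

text \<open>A discrete stochastic integral: \<open>b m\<close> is known at time m and leaves the
  conditional expectation of the increment, which is 0. The bound on b gives integrability.
  Differences of stopped martingales have this form.\<close>

lemma martingale_transform:
  assumes f: "martingale M F f"
    and b: "\<And>m. b m \<in> borel_measurable (F m)" and b1: "\<And>m x. \<bar>b m x\<bar> \<le> (1::real)"
  shows "martingale M F (\<lambda>n x. \<Sum>m<n. b m x * (f (Suc m) x - f m x))" (is "martingale M F ?g")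
proof (rule martingale_SucI)
  note fint[simp] = martingale_integrable[OF f] and fmeas = martingale_adapted[OF f]
  have bM[measurable]: "b m \<in> borel_measurable M" for m using b by (rule measurable_F_M)
  note [measurable] = martingale_measurable[OF f]
  have int: "integrable M (\<lambda>x. b m x * (f (Suc m) x - f m x))" for m
  proof (rule Bochner_Integration.integrable_bound)
    show "integrable M (\<lambda>x. f (Suc m) x - f m x)" by simp
    show "AE x in M. norm (b m x * (f (Suc m) x - f m x)) \<le> norm (f (Suc m) x - f m x)"
      by (intro AE_I2) (simp add: abs_mult mult_left_le_one_le b1)
  qed measurable
  show gint: "integrable M (?g n)" for n by (intro Bochner_Integration.integrable_sum int)
  show gmeas: "?g n \<in> borel_measurable (F n)" for n
    by (intro borel_measurable_sum borel_measurable_times borel_measurable_diff)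
      (auto intro: measurable_F_mono[OF _ b] measurable_F_mono[OF _ fmeas])
  fix n
  let ?d = "\<lambda>x. f (Suc n) x - f n x"
  have "AE x in M. real_cond_exp M (F n) (?g (Suc n)) x
      = real_cond_exp M (F n) (?g n) x + real_cond_exp M (F n) (\<lambda>x. b n x * ?d x) x"
    using ce.real_cond_exp_add[OF gint[of n] int[of n]] by simp
  moreover have "AE x in M. real_cond_exp M (F n) (?g n) x = ?g n x"
    by (intro ce.real_cond_exp_F_meas gint gmeas)
  moreover have "AE x in M. real_cond_exp M (F n) (\<lambda>x. b n x * ?d x) x = b n x * real_cond_exp M (F n) ?d x"
    by (intro ce.real_cond_exp_mult b int) measurable
  moreover have "AE x in M. real_cond_exp M (F n) ?d x = real_cond_exp M (F n) (f (Suc n)) x - real_cond_exp M (F n) (f n) x"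
    by simp
  moreover have "AE x in M. real_cond_exp M (F n) (f (Suc n)) x = f n x"
    by (rule martingale_cond_exp[OF f]) simp
  moreover have "AE x in M. real_cond_exp M (F n) (f n) x = f n x"
    by (rule martingale_cond_exp[OF f]) simp
  ultimately show "AE x in M. real_cond_exp M (F n) (?g (Suc n)) x = ?g n x"
    by eventually_elim simp
qed

section \<open>Square-integrable martingales: orthogonality and closure\<close>

lemma integrable_AE_bounded:
  fixes h :: "'a \<Rightarrow> real"
  assumes "h \<in> borel_measurable M" "AE x in M. \<bar>h x\<bar> \<le> C"
  shows "integrable M h"
  using assms by (intro integrable_const_bound[of _ C]) auto

lemma AE_bounded_mult:
  assumes "AE x in M. \<bar>h x\<bar> \<le> (C::real)" "AE x in M. \<bar>k x\<bar> \<le> D"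
  shows "AE x in M. \<bar>h x * k x\<bar> \<le> C * D"
  using assms
proof eventually_elim
  case (elim x)
  then show ?case unfolding abs_mult by (intro mult_mono) auto
qed

text \<open>Conditioning on \<open>F n\<close> turns the cross term \<open>g n * g m\<close> into
  the square of \<open>g n\<close>. The bounds \<open>c n\<close> may grow with n: they are there to
  make the products integrable.\<close>

lemma martingale_orthogonal_increments:
  assumes g: "martingale M F g" and bd: "\<And>n. AE x in M. \<bar>g n x\<bar> \<le> c n" and "n \<le> m"
  shows "(\<integral>x. (g m x - g n x)\<^sup>2 \<partial>M) = (\<integral>x. (g m x)\<^sup>2 \<partial>M) - (\<integral>x. (g n x)\<^sup>2 \<partial>M)"
proof -
  note [measurable] = martingale_measurable[OF g]
  have int: "integrable M (\<lambda>x. g i x * g j x)" for i j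
    by (rule integrable_AE_bounded[OF _ AE_bounded_mult[OF bd bd]]) simp
  have "(\<integral>x. g n x * g m x \<partial>M) = (\<integral>x. g n x * real_cond_exp M (F n) (g m) x \<partial>M)"
    by (intro ce.real_cond_exp_intg(2)[symmetric] int martingale_adapted[OF g]) simp
  also have "\<dots> = (\<integral>x. g n x * g n x \<partial>M)"
    using martingale_cond_exp[OF g \<open>n \<le> m\<close>] by (intro integral_cong_AE) auto
  finally have cross: "(\<integral>x. g n x * g m x \<partial>M) = (\<integral>x. g n x * g n x \<partial>M)" .
  have "(\<integral>x. (g m x - g n x)\<^sup>2 \<partial>M) = (\<integral>x. g m x * g m x - 2 * (g n x * g m x) + g n x * g n x \<partial>M)"
    by (intro Bochner_Integration.integral_cong) (auto simp: power2_eq_square algebra_simps)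
  also have "\<dots> = (\<integral>x. g m x * g m x \<partial>M) - 2 * (\<integral>x. g n x * g m x \<partial>M) + (\<integral>x. g n x * g n x \<partial>M)"
    using int by simp
  finally show ?thesis by (simp add: cross power2_eq_square)
qed

lemma martingale_L2_eq_sum_increments:
  assumes g: "martingale M F g" and bd: "\<And>n. AE x in M. \<bar>g n x\<bar> \<le> c n" and g0: "AE x in M. g 0 x = 0"
  shows "(\<integral>x. (g n x)\<^sup>2 \<partial>M) = (\<integral>x. (\<Sum>i<n. (g (Suc i) x - g i x)\<^sup>2) \<partial>M)"
proof (induction n)
  case 0
  note [measurable] = martingale_measurable[OF g]
  have "(\<integral>x. (g 0 x)\<^sup>2 \<partial>M) = (\<integral>x. 0 \<partial>M)"
    using g0 by (intro integral_cong_AE) auto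
  then show ?case by simp
next
  case (Suc n)
  note [measurable] = martingale_measurable[OF g]
  have "integrable M (\<lambda>x. (g (Suc i) x - g i x)\<^sup>2)" for i
  proof (rule integrable_AE_bounded)
    show "AE x in M. \<bar>(g (Suc i) x - g i x)\<^sup>2\<bar> \<le> (c (Suc i) + c i)\<^sup>2"
      using bd[of i] bd[of "Suc i"] by eventually_elim (rule abs_diff_power2_le)
  qed simp
  then show ?case
    using Suc.IH martingale_orthogonal_increments[OF g bd, of n "Suc n"] by simp
qed

text \<open>
  The limit is taken along a subsequence with \<open>\<parallel>g\<^bsub>r (j+1)\<^esub> - g\<^bsub>r j\<^esub>\<parallel>\<^sub>2 \<le> 2\<^sup>-\<^sup>j\<close>, which makes the
  increments summable in \<open>L\<^sup>1\<close>.
\<close>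

lemma martingale_closed_if_L2_bounded:
  assumes g: "martingale M F g" and bd: "\<And>n. AE x in M. \<bar>g n x\<bar> \<le> c n"
    and V: "\<And>n. (\<integral>x. (g n x)\<^sup>2 \<partial>M) \<le> V"
  shows "\<exists>a. integrable M a \<and> (\<forall>n. AE x in M. cond_seq M F a n x = g n x)"
proof -
  note [measurable] = martingale_measurable[OF g]
  note gint = martingale_integrable[OF g]
  define v where "v n = (\<integral>x. (g n x)\<^sup>2 \<partial>M)" for n
  note orth = martingale_orthogonal_increments[OF g bd, folded v_def]
  have inc: "v n \<le> v m" if "n \<le> m" for n m
  proof -
    have "0 \<le> (\<integral>x. (g m x - g n x)\<^sup>2 \<partial>M)" by simp
    then show ?thesis using orth[OF that] by simp
  qed
  obtain l where l: "v \<longlonglongrightarrow> l" "\<And>n. v n \<le> l"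
    using incseq_convergent[of v V] inc V unfolding v_def incseq_def by blast
  have "\<exists>r. \<forall>n\<ge>r. l - v n \<le> (1/4)^j" for j :: nat
  proof -
    have "\<forall>\<^sub>F n in sequentially. l - (1/4)^j < v n"
      by (rule order_tendstoD(1)[OF l(1)]) simp
    then obtain r where "\<And>n. n \<ge> r \<Longrightarrow> l - (1/4)^j < v n" unfolding eventually_sequentially by auto
    then show ?thesis by (intro exI[of _ r]) force
  qed
  then obtain r0 where r0: "\<And>j n. r0 j \<le> n \<Longrightarrow> l - v n \<le> (1/4)^j" by metis
  \<comment> \<open>Partial sums make the subsequence increasing and keep it above
    \<open>r0 j\<close>; the \<open>Suc\<close> also keeps it above j.\<close>
  define r where "r j = (\<Sum>i\<le>j. Suc (r0 i))" for j
  have r_Suc: "r j \<le> r (Suc j)" for j by (simp add: r_def)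
  have r_ge: "r0 j \<le> r j" for j unfolding r_def using member_le_sum[of j "{..j}" "\<lambda>i. Suc (r0 i)"] by simp
  have r_id: "j \<le> r j" for j by (induction j) (simp_all add: r_def)
  define h where "h j x = g (r (Suc j)) x - g (r j) x" for j x
  have hint: "integrable M (h j)" for j unfolding h_def by (simp add: gint)
  have hmeas[measurable]: "h j \<in> borel_measurable M" for j using hint by auto
  have h_L1: "(\<integral>x. \<bar>h j x\<bar> \<partial>M) \<le> (1/2)^j" for j
  proof -
    have sq: "(\<integral>x. (h j x)\<^sup>2 \<partial>M) \<le> (1/4)^j"
      unfolding h_def orth[OF r_Suc] using r0[OF r_ge, of j] l(2)[of "r (Suc j)"] by simp
    have int2: "integrable M (\<lambda>x. (h j x)\<^sup>2)"
    proof (rule integrable_AE_bounded)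
      show "AE x in M. \<bar>(h j x)\<^sup>2\<bar> \<le> (c (r (Suc j)) + c (r j))\<^sup>2"
        using bd[of "r j"] bd[of "r (Suc j)"] unfolding h_def
        by eventually_elim (rule abs_diff_power2_le)
    qed simp
    \<comment> \<open>Replaces the Cauchy-Schwarz inequality; the weight 2^j balances the bound 4^-j
      for the second moment against the constant 2^-j.\<close>
    have amgm: "\<bar>y\<bar> \<le> (2^j * y\<^sup>2 + (1/2)^j) / 2" for y :: real
    proof -
      define t :: real where "t = 2^j"
      have t: "0 < t" "(1/2)^j = 1 / t" by (simp_all add: t_def power_one_over)
      have "0 \<le> (t * \<bar>y\<bar> - 1)\<^sup>2 / t" using t by simp
      also have "\<dots> = t * \<bar>y\<bar>\<^sup>2 - 2 * \<bar>y\<bar> + 1 / t"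
        using t(1) by (simp add: power2_eq_square field_simps)
      finally show ?thesis unfolding t(2) t_def[symmetric] by simp
    qed
    have "(\<integral>x. \<bar>h j x\<bar> \<partial>M) \<le> (\<integral>x. (2^j * (h j x)\<^sup>2 + (1/2)^j) / 2 \<partial>M)"
      using hint int2 by (intro integral_mono amgm) auto
    also have "\<dots> = (2^j * (\<integral>x. (h j x)\<^sup>2 \<partial>M) + (1/2)^j) / 2"
      using int2 by (simp add: prob_space)
    also have "\<dots> \<le> (2^j * (1/4)^j + (1/2)^j) / 2"
      using sq by (intro divide_right_mono add_right_mono mult_left_mono) auto
    also have "2^j * (1/4)^j = (1/2 :: real)^j" unfolding power_mult_distrib[symmetric] by simp
    also have "((1/2)^j + (1/2)^j) / 2 = (1/2 :: real)^j" by simp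
    finally show ?thesis .
  qed
  have summ: "summable (\<lambda>j. \<integral>x. norm (h j x) \<partial>M)"
    by (rule summable_comparison_test'[of "\<lambda>j. (1/2)^j" 0]) (use h_L1 in auto)
  have "(\<integral>\<^sup>+x. (\<Sum>j. ennreal (norm (h j x))) \<partial>M) = (\<Sum>j. \<integral>\<^sup>+x. ennreal (norm (h j x)) \<partial>M)"
    by (rule nn_integral_suminf) simp
  also have "\<dots> = (\<Sum>j. ennreal (\<integral>x. norm (h j x) \<partial>M))"
    using hint by (intro suminf_cong nn_integral_eq_integral) auto
  also have "\<dots> \<noteq> \<infinity>"
    unfolding infinity_ennreal_def by (rule ennreal_suminf_neq_top[OF summ]) simp
  finally have "AE x in M. (\<Sum>j. ennreal (norm (h j x))) \<noteq> \<infinity>"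
    by (rule nn_integral_PInf_AE[rotated]) measurable
  then have ae_summ: "AE x in M. summable (\<lambda>j. norm (h j x))"
    unfolding infinity_ennreal_def by eventually_elim (rule summable_suminf_not_top[OF norm_ge_zero])
  define a where "a x = g (r 0) x + (\<Sum>j. h j x)" for x
  have aint: "integrable M a"
    unfolding a_def using integrable_suminf[OF hint ae_summ summ] gint by simp
  \<comment> \<open>Sets of \<open>F n\<close> characterise the conditional expectation. Over such A
    the series telescopes to the integral of \<open>g (r J)\<close>, which equals that of
    \<open>g n\<close> as soon as \<open>n \<le> r J\<close>, so the limit in J is that of an
    eventually constant sequence.\<close>
  have set_int: "(\<integral>x\<in>A. a x \<partial>M) = (\<integral>x\<in>A. g n x \<partial>M)" if A: "A \<in> sets (F n)" for A n
  proof -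
    have A_M[measurable]: "A \<in> sets M" using A by (rule sets_F_subset)
    let ?k = "\<lambda>j x. indicator A x * h j x"
    have kint: "integrable M (?k j)" for j
      using integrable_mult_indicator[OF A_M hint] by simp
    have kle: "\<bar>?k j x\<bar> \<le> \<bar>h j x\<bar>" for j x by (simp add: indicator_def)
    have ae_k: "AE x in M. summable (\<lambda>j. norm (?k j x))"
      using ae_summ
    proof eventually_elim
      case (elim x)
      then show ?case by (rule summable_comparison_test'[where N = 0]) (use kle in auto)
    qed
    have summ_k: "summable (\<lambda>j. \<integral>x. norm (?k j x) \<partial>M)"
    proof (rule summable_comparison_test'[OF summ, of 0])
      fix j :: nat
      have "(\<integral>x. norm (?k j x) \<partial>M) \<le> (\<integral>x. norm (h j x) \<partial>M)"
        using kint hint kle by (intro integral_mono) auto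
      then show "norm (\<integral>x. norm (?k j x) \<partial>M) \<le> (\<integral>x. norm (h j x) \<partial>M)" by simp
    qed
    have iint: "integrable M (\<lambda>x. indicator A x * g i x)" for i
      using integrable_mult_indicator[OF A_M gint] by simp
    have "(\<lambda>j. \<integral>x. ?k j x \<partial>M) sums (\<integral>x. (\<Sum>j. ?k j x) \<partial>M)"
      by (rule sums_integral[OF kint ae_k summ_k])
    moreover have "(\<integral>x. (\<Sum>j. ?k j x) \<partial>M) = (\<integral>x. indicator A x * (\<Sum>j. h j x) \<partial>M)"
    proof (rule integral_cong_AE)
      show "AE x in M. (\<Sum>j. ?k j x) = indicator A x * (\<Sum>j. h j x)"
        using ae_summ by eventually_elim (rule suminf_mult, rule summable_norm_cancel)
    qed simp_all
    moreover have "(\<Sum>j<J. \<integral>x. ?k j x \<partial>M) = (\<integral>x. indicator A x * g (r J) x \<partial>M) - (\<integral>x. indicator A x * g (r 0) x \<partial>M)" for J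
    proof -
      have "(\<Sum>j<J. \<integral>x. ?k j x \<partial>M)
          = (\<Sum>j<J. (\<integral>x. indicator A x * g (r (Suc j)) x \<partial>M) - (\<integral>x. indicator A x * g (r j) x \<partial>M))"
        unfolding h_def right_diff_distrib by (simp add: iint)
      also have "\<dots> = (\<integral>x. indicator A x * g (r J) x \<partial>M) - (\<integral>x. indicator A x * g (r 0) x \<partial>M)"
        by (rule sum_lessThan_telescope)
      finally show ?thesis .
    qed
    ultimately have "(\<lambda>J. (\<integral>x. indicator A x * g (r J) x \<partial>M) - (\<integral>x. indicator A x * g (r 0) x \<partial>M))
        \<longlonglongrightarrow> (\<integral>x. indicator A x * (\<Sum>j. h j x) \<partial>M)"
      unfolding sums_def by simp
    moreover have "\<forall>\<^sub>F J in sequentially. (\<integral>x. indicator A x * g (r J) x \<partial>M) - (\<integral>x. indicator A x * g (r 0) x \<partial>M)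
      = (\<integral>x. indicator A x * g n x \<partial>M) - (\<integral>x. indicator A x * g (r 0) x \<partial>M)"
    proof (rule eventually_sequentiallyI[of n])
      fix J assume "n \<le> J"
      then have nr: "n \<le> r J" using r_id[of J] by simp
      have "(\<integral>x\<in>A. g (r J) x \<partial>M) = (\<integral>x\<in>A. real_cond_exp M (F n) (g (r J)) x \<partial>M)"
        by (rule ce.real_cond_exp_intA[OF gint A])
      also have "\<dots> = (\<integral>x\<in>A. g n x \<partial>M)"
        using martingale_cond_exp[OF g nr] unfolding set_lebesgue_integral_def by (intro integral_cong_AE) auto
      finally show "(\<integral>x. indicator A x * g (r J) x \<partial>M) - (\<integral>x. indicator A x * g (r 0) x \<partial>M)
        = (\<integral>x. indicator A x * g n x \<partial>M) - (\<integral>x. indicator A x * g (r 0) x \<partial>M)"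
        by (simp add: set_lebesgue_integral_def)
    qed
    ultimately have "(\<integral>x. indicator A x * (\<Sum>j. h j x) \<partial>M)
        = (\<integral>x. indicator A x * g n x \<partial>M) - (\<integral>x. indicator A x * g (r 0) x \<partial>M)"
      by (rule LIMSEQ_unique[OF _ tendsto_eventually])
    moreover have "integrable M (\<lambda>x. indicator A x * (\<Sum>j. h j x))"
      using integrable_mult_indicator[OF A_M integrable_suminf[OF hint ae_summ summ]] by simp
    ultimately show ?thesis
      unfolding set_lebesgue_integral_def a_def by (simp add: distrib_left iint)
  qed
  have "AE x in M. cond_seq M F a n x = g n x" for n
    unfolding cond_seq_def
    by (rule ce.real_cond_exp_charact[OF set_int aint gint martingale_adapted[OF g]])
  then show ?thesis using aint by blast
qed

end

locale regular_stochastic_basis = stochastic_basis +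
  fixes R :: real
  assumes R_pos: "0 < R"
    and regular: "\<And>f n. martingale M F f \<Longrightarrow> (\<And>n. AE x in M. 0 \<le> f n x) \<Longrightarrow>
      AE x in M. f (Suc n) x \<le> R * f n x"
begin

interpretation ce: sigma_finite_subalgebra M "F n" for n
  by (rule sigma_finite_subalgebra_F)

text \<open>Regularity for the martingale of conditional probabilities of A, whose value at time
  \<open>Suc n\<close> is the indicator itself. All use of regularity passes through this
  inequality.\<close>

lemma indicator_le_cond_prob:
  assumes "A \<in> sets (F (Suc n))"
  shows "AE x in M. indicator A x \<le> R * real_cond_exp M (F n) (indicator A) x"
proof -
  have A[measurable]: "A \<in> sets M" using assms by (rule sets_F_subset)
  have int: "integrable M (indicator A :: 'a \<Rightarrow> real)"
    by (rule integrable_AE_bounded[of _ 1]) (simp_all add: indicator_def)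
  have "AE x in M. cond_seq M F (indicator A) (Suc n) x \<le> R * cond_seq M F (indicator A) n x"
    by (rule regular[OF martingale_cond_seq[OF int]]) (auto simp: cond_seq_def intro!: ce.real_cond_exp_pos)
  moreover have "AE x in M. real_cond_exp M (F (Suc n)) (indicator A) x = indicator A x"
    by (rule ce.real_cond_exp_F_meas[OF int]) (use assms in simp)
  ultimately show ?thesis unfolding cond_seq_def by eventually_elim simp
qed

end

section \<open>Musielak--Orlicz functions and atoms\<close>

lemma ennreal_rpow_le_imp_le:
  assumes "0 < p" "0 \<le> y" and "ennreal_rpow u (1 / p) \<le> ennreal y"
  shows "u \<le> ennreal (y powr p)"
proof (cases u rule: ennreal_cases)
  case (real r)
  then have "r powr (1 / p) \<le> y" using assms by (simp add: ennreal_rpow_def)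
  then have "(r powr (1 / p)) powr p \<le> y powr p" using assms by (intro powr_mono2) auto
  then show ?thesis using real assms by (cases "r = 0") (simp_all add: powr_powr ennreal_leI)
next
  case top
  then show ?thesis using assms(3) by (simp add: ennreal_rpow_def top_unique)
qed

lemma ennreal_rpow_ge:
  assumes "0 < p" "0 \<le> y" "ennreal y \<le> u"
  shows "ennreal (y powr p) \<le> ennreal_rpow u p"
proof (cases u rule: ennreal_cases)
  case (real r)
  then show ?thesis using assms by (simp add: ennreal_rpow_def ennreal_leI powr_mono2)
next
  case top
  then show ?thesis by (simp add: ennreal_rpow_def)
qed

text \<open>The lower type inequality is extended to s = 1 so that later choices of the form
  \<open>min 1 _\<close> need no case split; since \<phi> is positive, this goes with
  \<open>1 \<le> Cl\<close>.\<close>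

locale musielak_orlicz_space = prob_space M for M :: "'a measure" +
  fixes \<phi> :: "'a \<Rightarrow> real \<Rightarrow> real" and pm pp Cl Cu :: real
  assumes musielak_orlicz: "musielak_orlicz M \<phi>"
    and phi_finite: "0 < t \<Longrightarrow> (\<integral>\<^sup>+x. ennreal (\<phi> x t) \<partial>M) < \<infinity>"
    and pm_pos: "0 < pm" and Cl: "1 \<le> Cl"
    and lower: "x \<in> space M \<Longrightarrow> 0 \<le> t \<Longrightarrow> 0 < s \<Longrightarrow> s \<le> 1 \<Longrightarrow> \<phi> x (s * t) \<le> Cl * s powr pm * \<phi> x t"
    and pp_pos: "0 < pp" and Cu_pos: "0 < Cu"
    and upper: "x \<in> space M \<Longrightarrow> 0 \<le> t \<Longrightarrow> 1 \<le> s \<Longrightarrow> \<phi> x (s * t) \<le> Cu * s powr pp * \<phi> x t"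
begin

lemma phi_measurable: "0 \<le> t \<Longrightarrow> (\<lambda>x. \<phi> x t) \<in> borel_measurable M"
  and phi_nonneg: "x \<in> space M \<Longrightarrow> 0 \<le> t \<Longrightarrow> 0 \<le> \<phi> x t"
  and phi_0: "x \<in> space M \<Longrightarrow> \<phi> x 0 = 0"
  and phi_pos: "x \<in> space M \<Longrightarrow> 0 < t \<Longrightarrow> 0 < \<phi> x t"
  and phi_mono: "x \<in> space M \<Longrightarrow> 0 \<le> s \<Longrightarrow> s \<le> t \<Longrightarrow> \<phi> x s \<le> \<phi> x t"
  using musielak_orlicz by (auto simp: musielak_orlicz_def mono_on_def)

section \<open>The weighted measures E \<mapsto> \<phi>(E, t)\<close>

lemma phi_measure_eq_emeasure:
  assumes "0 \<le> t" "E \<in> sets M"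
  shows "phi_measure M \<phi> E t = emeasure (density M (\<lambda>x. ennreal (\<phi> x t))) E"
  using phi_measurable[OF assms(1)] assms(2) by (simp add: phi_measure_def emeasure_density)

lemma phi_measure_mono_AE:
  "AE x in M. x \<in> E \<longrightarrow> x \<in> E' \<Longrightarrow> phi_measure M \<phi> E t \<le> phi_measure M \<phi> E' t"
  unfolding phi_measure_def by (rule nn_integral_mono_AE) (auto simp: indicator_def)

lemma phi_measure_UN_le:
  assumes "0 \<le> t" "\<And>i :: nat. E i \<in> sets M"
  shows "phi_measure M \<phi> (\<Union>i. E i) t \<le> (\<Sum>i. phi_measure M \<phi> (E i) t)"
  using emeasure_subadditive_countably[of E "density M (\<lambda>x. ennreal (\<phi> x t))"] assms
  by (auto simp: phi_measure_eq_emeasure)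

lemma phi_measure_Un_le:
  assumes "0 \<le> t" "E \<in> sets M" "E' \<in> sets M"
  shows "phi_measure M \<phi> (E \<union> E') t \<le> phi_measure M \<phi> E t + phi_measure M \<phi> E' t"
  using emeasure_subadditive[of E "density M (\<lambda>x. ennreal (\<phi> x t))" E'] assms
  by (simp add: phi_measure_eq_emeasure)

lemma phi_measure_mono:
  assumes "0 \<le> s" "s \<le> t"
  shows "phi_measure M \<phi> E s \<le> phi_measure M \<phi> E t"
  unfolding phi_measure_def
  by (intro nn_integral_mono mult_right_mono ennreal_leI phi_mono assms) auto

lemma phi_measure_scale_le:
  assumes E: "E \<in> sets M" and "0 \<le> t" "0 \<le> s" "0 \<le> D"
    and le: "\<And>x. x \<in> space M \<Longrightarrow> \<phi> x (s * t) \<le> D * \<phi> x t"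
  shows "phi_measure M \<phi> E (s * t) \<le> ennreal D * phi_measure M \<phi> E t"
proof -
  note [measurable] = phi_measurable[OF \<open>0 \<le> t\<close>] E
  have "phi_measure M \<phi> E (s * t) \<le> (\<integral>\<^sup>+x. ennreal D * (ennreal (\<phi> x t) * indicator E x) \<partial>M)"
    unfolding phi_measure_def
  proof (rule nn_integral_mono)
    fix x assume x: "x \<in> space M"
    have "ennreal (\<phi> x (s * t)) \<le> ennreal D * ennreal (\<phi> x t)"
      using le[OF x] phi_nonneg[OF x \<open>0 \<le> t\<close>] \<open>0 \<le> D\<close> by (simp add: ennreal_leI flip: ennreal_mult)
    then show "ennreal (\<phi> x (s * t)) * indicator E x \<le> ennreal D * (ennreal (\<phi> x t) * indicator E x)"
      by (simp add: mult_right_mono flip: mult.assoc)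
  qed
  also have "\<dots> = ennreal D * phi_measure M \<phi> E t"
    unfolding phi_measure_def by (rule nn_integral_cmult) measurable
  finally show ?thesis .
qed

lemma phi_measure_lower:
  assumes "E \<in> sets M" "0 \<le> t" "0 < s" "s \<le> 1"
  shows "phi_measure M \<phi> E (s * t) \<le> ennreal (Cl * s powr pm) * phi_measure M \<phi> E t"
  using assms Cl by (intro phi_measure_scale_le lower) auto

lemma phi_measure_upper:
  assumes "E \<in> sets M" "0 \<le> t" "1 \<le> s"
  shows "phi_measure M \<phi> E (s * t) \<le> ennreal (Cu * s powr pp) * phi_measure M \<phi> E t"
  using assms Cu_pos by (intro phi_measure_scale_le upper) auto

lemma phi_measure_finite:
  assumes "0 < t"
  shows "phi_measure M \<phi> E t < \<infinity>"
proof -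
  have "phi_measure M \<phi> E t \<le> (\<integral>\<^sup>+x. ennreal (\<phi> x t) \<partial>M)"
    unfolding phi_measure_def by (intro nn_integral_mono) (auto simp: indicator_def)
  then show ?thesis using phi_finite[OF assms] by (rule le_less_trans)
qed

lemma phi_measure_null:
  assumes "AE x in M. x \<notin> E"
  shows "phi_measure M \<phi> E t = 0"
proof -
  have "phi_measure M \<phi> E t \<le> phi_measure M \<phi> {} t"
    using assms by (intro phi_measure_mono_AE) auto
  then show ?thesis by (simp add: phi_measure_def)
qed

lemma phi_measure_pos:
  assumes E: "E \<in> sets M" and "0 < t" and pos: "emeasure M E \<noteq> 0"
  shows "0 < phi_measure M \<phi> E t"
proof (rule ccontr)
  assume "\<not> 0 < phi_measure M \<phi> E t"
  then have "(\<integral>\<^sup>+x\<in>E. ennreal (\<phi> x t) \<partial>M) = 0" by (simp add: phi_measure_def)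
  then have "AE x in M. ennreal (\<phi> x t) * indicator E x = 0"
    using phi_measurable[of t] \<open>0 < t\<close> E by (subst (asm) nn_integral_0_iff_AE) auto
  then have "AE x in M. x \<notin> E"
    using AE_space
  proof eventually_elim
    case (elim x)
    then show ?case using phi_pos[of x t] \<open>0 < t\<close> by (auto simp: indicator_def split: if_splits)
  qed
  then show False using pos E by (subst (asm) AE_iff_measurable[OF E]) (auto dest: sets.sets_into_space)
qed

section \<open>The quasi-norm of an indicator function\<close>

lemma L_phi_norm_indicator:
  assumes B: "B \<in> sets M"
  shows "L_phi_norm M \<phi> (indicator B) = Inf {ennreal r | r. 0 < r \<and> phi_measure M \<phi> B (1 / r) \<le> 1}"
proof -
  have "(\<integral>\<^sup>+x. ennreal (\<phi> x (\<bar>indicator B x\<bar> / r)) \<partial>M) = phi_measure M \<phi> B (1 / r)" for r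
    unfolding phi_measure_def by (intro nn_integral_cong) (auto simp: indicator_def phi_0)
  then show ?thesis unfolding L_phi_norm_def by simp
qed

lemma L_phi_norm_indicator_finite:
  assumes B: "B \<in> sets M"
  shows "L_phi_norm M \<phi> (indicator B) < \<infinity>"
proof -
  obtain p where p: "0 \<le> p" "phi_measure M \<phi> B 1 = ennreal p"
    using phi_measure_finite[of 1 B] by (cases "phi_measure M \<phi> B 1" rule: ennreal_cases) auto
  \<comment> \<open>Solves \<open>Cl * s powr pm = 1 / (p + 1)\<close>, cut off at 1; p + 1 instead
    of p allows p = 0.\<close>
  define s where "s = min 1 ((1 / (Cl * (p + 1))) powr (1 / pm))"
  have s: "0 < s" "s \<le> 1" using Cl p(1) by (simp_all add: s_def)
  have "s powr pm \<le> ((1 / (Cl * (p + 1))) powr (1 / pm)) powr pm"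
    using s pm_pos by (intro powr_mono2) (auto simp: s_def)
  also have "\<dots> = 1 / (Cl * (p + 1))" using pm_pos Cl p(1) by (simp add: powr_powr)
  finally have "Cl * s powr pm \<le> Cl * (1 / (Cl * (p + 1)))" using Cl by (intro mult_left_mono) auto
  also have "\<dots> = 1 / (p + 1)" using Cl by simp
  finally have "Cl * s powr pm \<le> 1 / (p + 1)" .
  then have "Cl * s powr pm * p \<le> 1 / (p + 1) * p" using p(1) by (rule mult_right_mono)
  also have "\<dots> \<le> 1" using p(1) by simp
  finally have *: "Cl * s powr pm * p \<le> 1" .
  have "phi_measure M \<phi> B (s * 1) \<le> ennreal (Cl * s powr pm) * phi_measure M \<phi> B 1"
    by (rule phi_measure_lower[OF B _ s]) simp
  also have "\<dots> \<le> 1" using * p(1) Cl by (simp add: p(2) ennreal_le_1 flip: ennreal_mult)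
  finally have "phi_measure M \<phi> B (1 / (1 / s)) \<le> 1" by simp
  then have "L_phi_norm M \<phi> (indicator B) \<le> ennreal (1 / s)"
    unfolding L_phi_norm_indicator[OF B] using s by (intro Inf_lower) auto
  then show ?thesis by (simp add: le_less_trans)
qed

lemma L_phi_norm_indicator_null:
  assumes B: "B \<in> sets M" and "emeasure M B = 0"
  shows "L_phi_norm M \<phi> (indicator B) = 0"
proof -
  have "AE x in M. x \<notin> B" using assms by (intro AE_not_in) auto
  then have "phi_measure M \<phi> B t = 0" for t by (rule phi_measure_null)
  then have "L_phi_norm M \<phi> (indicator B) \<le> ennreal e" if "0 < e" for e
    unfolding L_phi_norm_indicator[OF B] using that by (intro Inf_lower) auto
  then show ?thesis by (metis ennreal_le_epsilon add_0 le_zero_eq)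
qed

lemma L_phi_norm_indicator_pos:
  assumes B: "B \<in> sets M" and pos: "emeasure M B \<noteq> 0"
  shows "0 < L_phi_norm M \<phi> (indicator B)"
proof -
  obtain p where p: "0 \<le> p" "phi_measure M \<phi> B 1 = ennreal p"
    using phi_measure_finite[of 1 B] by (cases "phi_measure M \<phi> B 1" rule: ennreal_cases) auto
  have p0: "0 < p" using phi_measure_pos[OF B _ pos, of 1] p by auto
  \<comment> \<open>For an admissible r \<le> 1, lower type with factor r and argument 1/r gives
    \<open>p \<le> Cl * r powr pm\<close>; this is the resulting lower bound for r.\<close>
  define r0 where "r0 = min 1 ((p / Cl) powr (1 / pm))"
  have r0: "0 < r0" using p0 Cl by (simp add: r0_def)
  have "ennreal r0 \<le> ennreal r" if r: "0 < r" "phi_measure M \<phi> B (1 / r) \<le> 1" for r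
  proof (cases "r \<le> 1")
    case True
    have "ennreal p \<le> ennreal (Cl * r powr pm) * phi_measure M \<phi> B (1 / r)"
      unfolding p(2)[symmetric] using phi_measure_lower[OF B, of "1 / r" r] r True by simp
    also have "\<dots> \<le> ennreal (Cl * r powr pm) * 1" using r by (intro mult_left_mono) auto
    finally have "p \<le> Cl * r powr pm" using Cl by (simp add: ennreal_le_iff)
    then have "p / Cl \<le> r powr pm" using Cl by (simp add: field_simps)
    then have "(p / Cl) powr (1 / pm) \<le> (r powr pm) powr (1 / pm)"
      using p0 Cl pm_pos by (intro powr_mono2) auto
    also have "\<dots> = r" using pm_pos r by (simp add: powr_powr)
    finally show ?thesis by (intro ennreal_leI) (simp add: r0_def)
  next
    case False
    then show ?thesis by (intro ennreal_leI) (simp add: r0_def)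
  qed
  then have "ennreal r0 \<le> L_phi_norm M \<phi> (indicator B)"
    unfolding L_phi_norm_indicator[OF B] by (intro Inf_greatest) auto
  moreover have "0 < ennreal r0" using r0 by simp
  ultimately show ?thesis by (rule less_le_trans[rotated])
qed

lemma L_phi_norm_indicator_cases:
  assumes "B \<in> sets M" "emeasure M B \<noteq> 0"
  obtains b where "0 < b" "L_phi_norm M \<phi> (indicator B) = ennreal b"
  using L_phi_norm_indicator_pos[OF assms] L_phi_norm_indicator_finite[OF assms(1)]
  by (cases "L_phi_norm M \<phi> (indicator B)" rule: ennreal_cases) auto

end

section \<open>Supports and level sets of atoms\<close>

lemma hit_set_eq_UN: "hit_set M \<nu> = (\<Union>n. {x \<in> space M. \<nu> x \<le> enat n})"
proof -
  have "\<nu> x < \<infinity> \<longleftrightarrow> (\<exists>n. \<nu> x \<le> enat n)" for x by (cases "\<nu> x") auto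
  then show ?thesis unfolding hit_set_def by auto
qed

lemma ext_stopping_timeD:
  assumes "ext_stopping_time M F \<nu>" "subalgebra M (F n)"
  shows "{x \<in> space M. \<nu> x \<le> enat n} \<in> sets (F n)"
proof -
  have "Measurable.pred (F n) (\<lambda>x. \<nu> x \<le> enat n)"
    using assms(1) unfolding ext_stopping_time_def stopping_time_def by (auto dest: spec[of _ "enat n"])
  then show ?thesis using assms(2) by (simp add: pred_def subalgebra_def)
qed

lemma hit_set_sets:
  assumes "ext_stopping_time M F \<nu>" "\<And>n. subalgebra M (F n)"
  shows "hit_set M \<nu> \<in> sets M"
proof -
  have "{x \<in> space M. \<nu> x \<le> enat n} \<in> sets M" for n
    using ext_stopping_timeD[OF assms] assms(2)[of n] by (auto simp: subalgebra_def)
  then show ?thesis unfolding hit_set_eq_UN by auto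
qed

locale martingale_operator_orlicz =
  martingale_operator T N + musielak_orlicz_space M \<phi> pm pp Cl Cu + stochastic_basis M F
  for T :: "(nat \<Rightarrow> 'a \<Rightarrow> real) \<Rightarrow> 'a \<Rightarrow> ennreal" and N and M :: "'a measure" and \<phi> pm pp Cl Cu F
begin

lemma atom_hit_set: "is_atom T M F \<phi> q a \<nu> \<Longrightarrow> hit_set M \<nu> \<in> sets M"
  by (intro hit_set_sets[of M F]) (auto simp: is_atom_def subalgebra_F)

lemma T_cond_seq_measurable [measurable]: "T (cond_seq M F a) \<in> borel_measurable M"
  by (rule T_measurable) (simp add: cond_seq_def)

lemma atom_support:
  assumes "is_atom T M F \<phi> q a \<nu>"
  shows "AE x in M. x \<notin> hit_set M \<nu> \<longrightarrow> (\<forall>n. cond_seq M F a n x = 0)"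
proof -
  have "AE x in M. \<forall>n. enat n \<le> \<nu> x \<longrightarrow> cond_seq M F a n x = 0"
    using assms by (simp add: AE_all_countable is_atom_def)
  then show ?thesis using AE_space
    by eventually_elim (auto simp: hit_set_def)
qed

text \<open>For finite q this is Chebyshev's inequality with weight \<phi>(., t), available for each
  t because the atom norm is a supremum over t. For q = \<infinity> every positive \<open>q0\<close>
  works: the set is null if \<open>m \<le> \<beta>\<close>, and otherwise it lies in B up to a null
  set while the factor is at least 1.\<close>

lemma atom_chebyshev:
  assumes atom: "is_atom T M F \<phi> q a \<nu>" and q: "0 < q" "q \<noteq> \<infinity> \<Longrightarrow> q0 = enn2real q" "0 < q0"
    and "0 < t" "0 < \<beta>" "0 < m"
  defines "B \<equiv> hit_set M \<nu>"
  shows "phi_measure M \<phi> {x \<in> space M. ennreal \<beta> <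
      ennreal (m * enn2real (L_phi_norm M \<phi> (indicator B))) * T (cond_seq M F a) x} t
    \<le> ennreal ((m / \<beta>) powr q0) * phi_measure M \<phi> B t" (is "phi_measure M \<phi> ?E t \<le> _")
proof (cases "emeasure M B = 0")
  case True
  then have "?E = {}"
    using L_phi_norm_indicator_null[OF atom_hit_set[OF atom]] by (simp add: B_def)
  then show ?thesis by (simp add: phi_measure_def)
next
  case False
  have B: "B \<in> sets M" unfolding B_def by (rule atom_hit_set[OF atom])
  obtain b where b: "0 < b" "L_phi_norm M \<phi> (indicator B) = ennreal b"
    using L_phi_norm_indicator_cases[OF B False] .
  let ?T = "T (cond_seq M F a)"
  have norm: "L_phi_q_norm M \<phi> q B ?T \<le> ennreal (1 / b)"
    using atom False b by (simp add: is_atom_def B_def inverse_ennreal inverse_eq_divide)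
  \<comment> \<open>The level for \<open>T a\<close> itself once the coefficient
    \<open>m * b\<close> is divided out.\<close>
  define z where "z = \<beta> / (m * b)"
  have z: "0 < z" using assms b by (simp add: z_def)
  have E_iff: "x \<in> ?E \<longleftrightarrow> x \<in> space M \<and> ennreal z < ?T x" for x
  proof (cases "?T x" rule: ennreal_cases)
    case (real r)
    then show ?thesis using assms(6,7) b
      by (simp add: z_def ennreal_less_iff field_simps flip: ennreal_mult)
  next
    case top
    then show ?thesis using assms(6,7) b by (simp add: ennreal_mult_top z_def)
  qed
  show ?thesis
  proof (cases "q = \<infinity>")
    case True
    have T_le: "AE x in M. ?T x \<le> ennreal (1 / b)"
      using esssup_AE[of ?T M] norm True by (auto simp: L_phi_q_norm_def elim!: eventually_mono intro: order_trans)
    show ?thesis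
    proof (cases "m \<le> \<beta>")
      case True
      then have "1 / b \<le> z" using assms(6,7) b by (simp add: z_def field_simps)
      then have "AE x in M. x \<notin> ?E"
        using T_le unfolding E_iff by (auto elim!: eventually_mono dest!: ennreal_leI)
      then show ?thesis by (simp add: phi_measure_null)
    next
      case False
      have "AE x in M. x \<in> ?E \<longrightarrow> x \<in> B"
        using atom_support[OF atom]
      proof eventually_elim
        case (elim x)
        then show ?case unfolding E_iff using T_eq_0[of "cond_seq M F a" x] by (auto simp: B_def)
      qed
      then have "phi_measure M \<phi> ?E t \<le> 1 * phi_measure M \<phi> B t"
        using phi_measure_mono_AE by simp
      also have "\<dots> \<le> ennreal ((m / \<beta>) powr q0) * phi_measure M \<phi> B t"
        using False assms(6,7) q by (intro mult_right_mono) (auto intro!: ge_one_powr_ge_zero simp: ennreal_ge_1)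
      finally show ?thesis .
    qed
  next
    case False
    then have q0: "q0 = enn2real q" by (rule q)
    obtain p where p: "0 < p" "phi_measure M \<phi> B t = ennreal p"
      using phi_measure_finite[OF \<open>0 < t\<close>, of B] phi_measure_pos[OF B \<open>0 < t\<close> \<open>emeasure M B \<noteq> 0\<close>]
      by (cases "phi_measure M \<phi> B t" rule: ennreal_cases) auto
    define I where "I = (\<integral>\<^sup>+x. ennreal_rpow (?T x) q0 * ennreal (\<phi> x t) \<partial>M)"
    have "ennreal_rpow (1 / ennreal p * I) (1 / q0) \<le> ennreal (1 / b)"
      using norm False \<open>0 < t\<close> unfolding L_phi_q_norm_def q0[symmetric] I_def p(2)[symmetric]
      by (auto simp: SUP_le_iff)
    then have "1 / ennreal p * I \<le> ennreal ((1 / b) powr q0)"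
      using q b by (intro ennreal_rpow_le_imp_le) auto
    then have "ennreal p * (1 / ennreal p * I) \<le> ennreal p * ennreal ((1 / b) powr q0)"
      by (rule mult_left_mono) simp
    moreover have "ennreal p * (1 / ennreal p * I) = I"
      using p(1) divide_ennreal[of 1 p] by (simp add: mult.assoc[symmetric] ennreal_mult[symmetric])
    ultimately have I_le: "I \<le> ennreal (p * (1 / b) powr q0)" using p by (simp add: ennreal_mult)
    have "ennreal (z powr q0) * phi_measure M \<phi> ?E t
        = (\<integral>\<^sup>+x. ennreal (z powr q0) * (ennreal (\<phi> x t) * indicator ?E x) \<partial>M)"
      unfolding phi_measure_def using phi_measurable[of t] \<open>0 < t\<close>
      by (intro nn_integral_cmult[symmetric] borel_measurable_times_ennreal) auto
    also have "\<dots> \<le> I"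
      unfolding I_def
    proof (rule nn_integral_mono)
      fix x assume x: "x \<in> space M"
      show "ennreal (z powr q0) * (ennreal (\<phi> x t) * indicator ?E x) \<le> ennreal_rpow (?T x) q0 * ennreal (\<phi> x t)"
      proof (cases "x \<in> ?E")
        case True
        then have "ennreal (z powr q0) \<le> ennreal_rpow (?T x) q0"
          unfolding E_iff using z q by (intro ennreal_rpow_ge) auto
        then show ?thesis using True by (simp add: mult_right_mono)
      qed simp
    qed
    also note I_le
    finally have le: "ennreal (z powr q0) * phi_measure M \<phi> ?E t \<le> ennreal (p * (1 / b) powr q0)" .
    obtain e where e: "0 \<le> e" "phi_measure M \<phi> ?E t = ennreal e"
      using phi_measure_finite[OF \<open>0 < t\<close>, of ?E] by (cases "phi_measure M \<phi> ?E t" rule: ennreal_cases) auto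
    have "z powr q0 * e \<le> p * (1 / b) powr q0"
      using le p e by (simp add: ennreal_le_iff flip: ennreal_mult)
    then have "e \<le> p * ((1 / b) powr q0 / z powr q0)"
      using z by (simp add: field_simps)
    also have "(1 / b) powr q0 / z powr q0 = (m / \<beta>) powr q0"
      using b z assms(6,7) by (simp add: z_def field_simps flip: powr_divide)
    finally show ?thesis unfolding e(2) p(2) using p(1)
      by (simp add: mult.commute flip: ennreal_mult)
  qed
qed

end

section \<open>From atoms to the weak Hardy space\<close>

lemma power_powr: "0 < x \<Longrightarrow> (x ^ n) powr a = (x powr a) ^ n" for x a :: real
  by (induction n) (simp_all add: powr_mult)

lemma sum_power_le_geometric:
  fixes x :: real
  assumes "0 \<le> x" "x < 1" "finite J"
  shows "(\<Sum>j\<in>J. x ^ j) \<le> 1 / (1 - x)"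
proof -
  have "(\<Sum>j\<in>J. x ^ j) \<le> (\<Sum>j. x ^ j)"
    using assms by (intro sum_le_suminf summable_geometric) auto
  then show ?thesis using assms by (simp add: suminf_geometric)
qed

lemma suminf_ennreal_geometric:
  fixes x C :: real
  assumes "0 \<le> x" "x < 1" "0 \<le> C"
  shows "(\<Sum>j. ennreal (C * x ^ j)) = ennreal (C / (1 - x))"
proof -
  have "(\<lambda>j. C * x ^ j) sums (C * (1 / (1 - x)))"
    using assms by (intro sums_mult geometric_sums) auto
  then show ?thesis using assms by (intro suminf_ennreal_eq) auto
qed

lemma dyadic_floor:
  fixes \<alpha> :: real
  assumes "0 < \<alpha>"
  obtains k :: int where "2 powi k \<le> \<alpha>" "\<alpha> < 2 * 2 powi k"
proof
  let ?k = "\<lfloor>log 2 \<alpha>\<rfloor>"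
  have eq: "2 powi ?k = 2 powr real_of_int ?k" by (simp add: powr_real_of_int')
  have "2 powr real_of_int ?k \<le> 2 powr (log 2 \<alpha>)" by (intro powr_mono) auto
  then show "2 powi ?k \<le> \<alpha>" using assms by (simp add: eq)
  have "2 powr (log 2 \<alpha>) < 2 powr (1 + real_of_int ?k)" by (intro powr_less_mono) linarith+
  then show "\<alpha> < 2 * 2 powi ?k" using assms by (simp add: eq powr_add)
qed

text \<open>Reduces the quasi-norm to dyadic arguments. In the factor 2/s, the 2 pays for rounding
  \<alpha> down to a power of 2, and 1/s shrinks the argument so that lower type absorbs C.\<close>

lemma (in musielak_orlicz_space) WL_norm_le:
  assumes g: "g \<in> borel_measurable M" and "0 < r" "0 < s" "s \<le> 1" "0 < C" "Cl * s powr pm * C \<le> 1"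
    and distr: "\<And>\<alpha> k. 2 powi k \<le> \<alpha> \<Longrightarrow>
      phi_measure M \<phi> {x \<in> space M. ennreal \<alpha> < g x} (2 powi k / r) \<le> ennreal C"
  shows "WL_norm M \<phi> g \<le> ennreal (2 / s * r)"
  unfolding WL_norm_def
proof (rule Inf_lower, rule CollectI, rule exI[of _ "2 / s * r"], intro conjI refl SUP_least)
  show "0 < 2 / s * r" using assms by simp
  fix \<alpha> :: real assume "\<alpha> \<in> {0<..}"
  then obtain k where k: "2 powi k \<le> \<alpha>" "\<alpha> < 2 * 2 powi k" using dyadic_floor[of \<alpha>] by auto
  let ?E = "{x \<in> space M. ennreal \<alpha> < g x}"
  have E: "?E \<in> sets M" using g by measurable
  have "phi_measure M \<phi> ?E (\<alpha> / (2 / s * r)) \<le> phi_measure M \<phi> ?E (s * (2 powi k / r))"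
    using k \<open>\<alpha> \<in> {0<..}\<close> assms by (intro phi_measure_mono) (auto simp: field_simps)
  also have "\<dots> \<le> ennreal (Cl * s powr pm) * phi_measure M \<phi> ?E (2 powi k / r)"
    using assms E by (intro phi_measure_lower) auto
  also have "\<dots> \<le> ennreal (Cl * s powr pm) * ennreal C"
    by (intro mult_left_mono distr k) simp
  also have "\<dots> \<le> 1" using assms Cl by (simp flip: ennreal_mult)
  finally show "phi_measure M \<phi> ?E (\<alpha> / (2 / s * r)) \<le> 1" .
qed

text \<open>Trades a multiplicative constant for a dilation; both comparisons of quasi-norms rest on
  it.\<close>

lemma (in musielak_orlicz_space) small_scale:
  assumes "0 < C"
  obtains s where "0 < s" "s \<le> 1" "Cl * s powr pm * C \<le> 1"
proof
  define s where "s = min 1 ((1 / (Cl * C)) powr (1 / pm))"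
  show s: "0 < s" "s \<le> 1" using Cl assms by (simp_all add: s_def)
  have "s powr pm \<le> ((1 / (Cl * C)) powr (1 / pm)) powr pm"
    using s pm_pos by (intro powr_mono2) (auto simp: s_def)
  also have "\<dots> = 1 / (Cl * C)" using pm_pos Cl assms by (simp add: powr_powr)
  finally have "(Cl * C) * s powr pm \<le> (Cl * C) * (1 / (Cl * C))"
    using Cl assms by (intro mult_left_mono) auto
  then show "Cl * s powr pm * C \<le> 1" using Cl assms by (simp add: ac_simps)
qed

context martingale_operator_orlicz
begin

text \<open>
  For \<open>2\<^sup>K \<le> \<alpha>\<close> the atoms with index \<open>k \<ge> K\<close> only matter on their supports. Below \<open>K\<close>, the geometric
  weights \<open>(1 - \<theta>) \<theta>\<^sup>j\<close> of total mass \<open>1\<close> replace Minkowski's inequality by a union bound; \<open>\<theta>\<close> is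
  close enough to \<open>1\<close> for the Chebyshev bounds to remain summable, as \<open>q > pp\<close>.
\<close>

lemma atomic_decomp_distribution:
  assumes dec: "(a, \<nu>) \<in> atomic_decomps T M F \<phi> q c f" and f: "\<And>n. f n \<in> borel_measurable M"
    and q: "0 < q" "q \<noteq> \<infinity> \<Longrightarrow> q0 = enn2real q" "pp < q0" and "0 < c" "0 < r"
    and r: "(SUP k. phi_measure M \<phi> (hit_set M (\<nu> k)) (2 powi k / r)) \<le> 1"
    and \<alpha>: "2 powi K \<le> \<alpha>"
    and \<delta>_def: "\<delta> = (1 / 2) powr pm" and \<theta>_def: "\<theta> = 2 powr (- (q0 - pp) / (2 * q0))"
    and \<eta>_def: "\<eta> = 2 powr (- (q0 - pp) / 2)"
  shows "phi_measure M \<phi> {x \<in> space M. ennreal \<alpha> < T f x} (2 powi K / r)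
    \<le> ennreal (Cl / (1 - \<delta>) + Cu * (c / (1 - \<theta>)) powr q0 / (1 - \<eta>))"
proof -
  define t where "t = 2 powi K / r"
  have t: "0 < t" using \<open>0 < r\<close> by (simp add: t_def)
  have \<alpha>_pos: "0 < \<alpha>" by (rule less_le_trans[OF _ \<alpha>]) simp
  have q0: "0 < q0" using q pp_pos by simp
  have \<delta>: "0 < \<delta>" "\<delta> < 1"
    using pm_pos powr_less_mono2[of pm "1/2" 1] by (simp_all add: \<delta>_def)
  have \<theta>: "0 < \<theta>" "\<theta> < 1" and \<eta>: "0 < \<eta>" "\<eta> < 1"
    using q q0 powr_less_mono[of _ 0 "2::real"] by (simp_all add: \<theta>_def \<eta>_def divide_less_0_iff)
  \<comment> \<open>The exponents are fitted to each other: Chebyshev and upper type together decay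
    like 2^(pp - q0) = \<eta>^2 per step, the weights cost a factor 1/\<eta>, and the ratio \<eta> <
    1 remains.\<close>
  have \<theta>\<eta>: "\<theta> powr q0 = \<eta>" using q0 by (simp add: \<theta>_def \<eta>_def powr_powr)
  have \<eta>2: "(1/2) powr q0 * 2 powr pp = \<eta> * \<eta>"
    by (simp add: \<eta>_def powr_divide powr_diff powr_minus field_simps flip: powr_add)
  define B where "B k = hit_set M (\<nu> k)" for k
  define \<mu> where "\<mu> = atom_coeff M \<phi> c \<nu>"
  have atom: "is_atom T M F \<phi> q (a k) (\<nu> k)" for k
    using dec by (auto simp: atomic_decomps_def)
  have B[measurable]: "B k \<in> sets M" for k unfolding B_def by (rule atom_hit_set[OF atom])
  have B_le: "phi_measure M \<phi> (B k) (2 powi k / r) \<le> 1" for k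
    unfolding B_def by (rule order_trans[OF SUP_upper r]) simp
  have \<mu>_nonneg: "0 \<le> \<mu> k" for k using \<open>0 < c\<close> by (simp add: \<mu>_def atom_coeff_def)
  define w where "w j = (1 - \<theta>) * \<theta> ^ j" for j
  have w: "0 < w j" for j using \<theta> by (simp add: w_def)
  define A where "A j = B (K + int j)" for j
  \<comment> \<open>Here j counts downwards from K - 1, and the j-th atom is allotted the share
    \<open>w j\<close> of the level \<alpha>.\<close>
  define E where "E j = {x \<in> space M. ennreal (w j * \<alpha>) < ennreal (\<mu> (K - 1 - int j)) * T (cond_seq M F (a (K - 1 - int j))) x}" for j
  have A_sets: "A j \<in> sets M" for j by (simp add: A_def)
  have E_sets: "E j \<in> sets M" for j unfolding E_def by measurable
  have A_le: "phi_measure M \<phi> (A j) t \<le> ennreal (Cl * \<delta> ^ j)" for j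
  proof -
    have "t = (1/2) ^ j * (2 powi (K + int j) / r)"
      by (simp add: t_def power_int_add power_one_over)
    then have "phi_measure M \<phi> (A j) t \<le> ennreal (Cl * ((1/2) ^ j) powr pm) * phi_measure M \<phi> (A j) (2 powi (K + int j) / r)"
      using A_sets \<open>0 < r\<close> by (simp only:) (intro phi_measure_lower, auto simp: power_le_one)
    also have "\<dots> \<le> ennreal (Cl * ((1/2) ^ j) powr pm) * 1"
      unfolding A_def by (intro mult_left_mono B_le) simp
    finally show ?thesis by (simp add: power_powr \<delta>_def)
  qed
  \<comment> \<open>Upper type moves the argument from 2^k / r, where the hypothesis on
    \<open>B k\<close> holds, up to t = 2^K / r, a factor 2^(j+1); Chebyshev with exponent
    \<open>q0\<close> more than compensates for it.\<close>
  have E_le: "phi_measure M \<phi> (E j) t \<le> ennreal (Cu * (c / (1 - \<theta>)) powr q0 * \<eta> ^ j)" for j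
  proof -
    define k where "k = K - 1 - int j"
    have K: "2 powi K = 2 ^ Suc j * (2 powi k :: real)"
    proof -
      have "2 powi K = (2 powi (int (Suc j) + k) :: real)" by (simp add: k_def)
      also have "\<dots> = 2 powi int (Suc j) * 2 powi k" by (rule power_int_add) simp
      finally show ?thesis by (simp only: power_int_of_nat)
    qed
    have "phi_measure M \<phi> (E j) t \<le> ennreal ((c * 2 powi k / (w j * \<alpha>)) powr q0) * phi_measure M \<phi> (B k) t"
      using atom_chebyshev[OF atom[of k] q(1,2) q0 t, of "w j * \<alpha>" "c * 2 powi k"] w \<alpha>_pos \<open>0 < c\<close>
      by (simp add: E_def \<mu>_def atom_coeff_def B_def k_def)
    also have "\<dots> \<le> ennreal ((c * 2 powi k / (w j * \<alpha>)) powr q0) * ennreal (Cu * (2 ^ Suc j) powr pp)"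
    proof (rule mult_left_mono)
      have "phi_measure M \<phi> (B k) t = phi_measure M \<phi> (B k) (2 ^ Suc j * (2 powi k / r))"
        by (simp add: t_def K)
      also have "\<dots> \<le> ennreal (Cu * (2 ^ Suc j) powr pp) * phi_measure M \<phi> (B k) (2 powi k / r)"
        using \<open>0 < r\<close> by (intro phi_measure_upper B) (auto simp del: power_Suc)
      also have "\<dots> \<le> ennreal (Cu * (2 ^ Suc j) powr pp) * 1" by (intro mult_left_mono B_le) simp
      finally show "phi_measure M \<phi> (B k) t \<le> ennreal (Cu * (2 ^ Suc j) powr pp)" by simp
    qed simp
    also have "\<dots> = ennreal ((c * 2 powi k / (w j * \<alpha>)) powr q0 * (Cu * (2 ^ Suc j) powr pp))"
      using Cu_pos by (simp add: ennreal_mult)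
    also have "\<dots> \<le> ennreal (Cu * (c / (1 - \<theta>)) powr q0 * \<eta> ^ j)"
    proof (rule ennreal_leI)
      have "c * 2 powi k / (w j * \<alpha>) \<le> c * 2 powi k / (w j * 2 powi K)"
        using w[of j] \<alpha> \<alpha>_pos \<open>0 < c\<close> by (intro divide_left_mono mult_left_mono) auto
      also have "\<dots> = c / (1 - \<theta>) * ((1/2) ^ Suc j / \<theta> ^ j)"
        unfolding K w_def using \<theta> by (simp add: power_one_over field_simps)
      finally have "(c * 2 powi k / (w j * \<alpha>)) powr q0 \<le> (c / (1 - \<theta>) * ((1/2) ^ Suc j / \<theta> ^ j)) powr q0"
        using w[of j] \<alpha>_pos \<open>0 < c\<close> q0 by (intro powr_mono2) auto
      also have "\<dots> = (c / (1 - \<theta>)) powr q0 * (((1/2) powr q0) ^ Suc j / \<eta> ^ j)"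
        using \<theta> \<open>0 < c\<close> unfolding \<theta>\<eta>[symmetric]
        by (simp add: powr_mult powr_divide power_powr flip: power_Suc)
      finally have "(c * 2 powi k / (w j * \<alpha>)) powr q0 * (Cu * (2 ^ Suc j) powr pp)
          \<le> (c / (1 - \<theta>)) powr q0 * (((1/2) powr q0) ^ Suc j / \<eta> ^ j) * (Cu * (2 ^ Suc j) powr pp)"
        using Cu_pos by (intro mult_right_mono) auto
      also have "\<dots> = Cu * (c / (1 - \<theta>)) powr q0 * (((1/2) powr q0 * 2 powr pp) ^ Suc j / \<eta> ^ j)"
        by (simp add: power_powr power_mult_distrib del: power_Suc)
      also have "((1/2) powr q0 * 2 powr pp) ^ Suc j / \<eta> ^ j = \<eta> ^ j * \<eta>\<^sup>2"
        unfolding \<eta>2 using \<eta> by (simp add: power_mult_distrib power2_eq_square)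
      also have "Cu * (c / (1 - \<theta>)) powr q0 * (\<eta> ^ j * \<eta>\<^sup>2) \<le> Cu * (c / (1 - \<theta>)) powr q0 * (\<eta> ^ j * 1)"
        using \<eta> Cu_pos by (intro mult_left_mono) (auto simp: power_le_one)
      finally show "(c * 2 powi k / (w j * \<alpha>)) powr q0 * (Cu * (2 ^ Suc j) powr pp)
          \<le> Cu * (c / (1 - \<theta>)) powr q0 * \<eta> ^ j" by simp
    qed
    finally show ?thesis .
  qed
  have sums: "AE x in M. \<forall>n. ((\<lambda>k. \<mu> k * cond_seq M F (a k) n x) has_sum f n x) UNIV"
    using dec by (simp add: AE_all_countable atomic_decomps_def \<mu>_def)
  have supp: "AE x in M. \<forall>k. x \<notin> B k \<longrightarrow> (\<forall>n. cond_seq M F (a k) n x = 0)"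
    unfolding AE_all_countable B_def using atom_support[OF atom] by blast
  have "AE x in M. x \<in> {x \<in> space M. ennreal \<alpha> < T f x} \<longrightarrow> x \<in> (\<Union>j. A j) \<union> (\<Union>j. E j)"
    using sums supp AE_space
  proof eventually_elim
    case (elim x)
    show ?case
    proof (rule impI, rule ccontr)
      assume x: "x \<in> {x \<in> space M. ennreal \<alpha> < T f x}" and notin: "x \<notin> (\<Union>j. A j) \<union> (\<Union>j. E j)"
      define u where "u k i = \<mu> k * cond_seq M F (a k) i x" for k i
      have high: "N n (u k) = 0" if "K \<le> k" for k n
      proof -
        have "k = K + int (nat (k - K))" using that by simp
        then have "x \<notin> B k" using notin unfolding A_def by (metis UN_I UnI1 UNIV_I)
        then have "u k = (\<lambda>_. 0 * 0)" using elim(2) by (auto simp: u_def)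
        then show ?thesis using N_scale[of n 0 "\<lambda>_. 0"] by simp
      qed
      have low: "N n (u k) \<le> w (nat (K - 1 - k)) * \<alpha>" if "k < K" for k n
      proof -
        define j where "j = nat (K - 1 - k)"
        have k: "K - 1 - int j = k" using that by (simp add: j_def)
        have "x \<notin> E j" using notin by blast
        then have "ennreal (\<mu> k) * T (cond_seq M F (a k)) x \<le> ennreal (w j * \<alpha>)"
          using elim(3) by (simp add: E_def k not_less)
        moreover have "ennreal (N n (u k)) \<le> ennreal (\<mu> k) * T (cond_seq M F (a k)) x"
          unfolding u_def N_scale using \<mu>_nonneg N_le_T[of n "cond_seq M F (a k)" x]
          by (simp add: ennreal_mult N_nonneg mult_left_mono)
        ultimately have "ennreal (N n (u k)) \<le> ennreal (w j * \<alpha>)" by (rule order_trans[rotated])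
        then show ?thesis unfolding j_def using w[of "nat (K - 1 - k)"] \<alpha>_pos by (subst (asm) ennreal_le_iff) auto
      qed
      \<comment> \<open>Off the exceptional sets the terms with k \<ge> K vanish and the others are
        within their shares, so every finite partial sum stays below \<alpha>.\<close>
      have fin: "(\<Sum>k\<in>L. N n (u k)) \<le> \<alpha>" if L: "finite L" for L n
      proof -
        let ?J = "(\<lambda>k. nat (K - 1 - k)) ` {k \<in> L. k < K}"
        have "(\<Sum>k\<in>L. N n (u k)) = (\<Sum>k\<in>{k \<in> L. k < K}. N n (u k))"
          using L by (intro sum.mono_neutral_right) (auto, metis high not_le_imp_less)
        also have "\<dots> \<le> (\<Sum>k\<in>{k \<in> L. k < K}. w (nat (K - 1 - k)) * \<alpha>)"
          by (intro sum_mono low) auto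
        also have "\<dots> = (\<Sum>j\<in>?J. w j * \<alpha>)"
          by (subst sum.reindex) (auto simp: inj_on_def)
        also have "\<dots> = (1 - \<theta>) * \<alpha> * (\<Sum>j\<in>?J. \<theta> ^ j)"
          by (simp add: w_def sum_distrib_left mult_ac)
        also have "\<dots> \<le> (1 - \<theta>) * \<alpha> * (1 / (1 - \<theta>))"
          using \<theta> \<alpha>_pos L by (intro mult_left_mono sum_power_le_geometric) auto
        also have "\<dots> = \<alpha>" using \<theta> by simp
        finally show ?thesis .
      qed
      have "N n (\<lambda>i. f i x) \<le> \<alpha>" for n
        using elim(1) fin by (intro N_has_sum_le[where u = u]) (auto simp: u_def)
      then have "T f x \<le> ennreal \<alpha>" by (rule T_leI)
      then show False using x leD by blast
    qed
  qed
  then have "phi_measure M \<phi> {x \<in> space M. ennreal \<alpha> < T f x} t \<le> phi_measure M \<phi> ((\<Union>j. A j) \<union> (\<Union>j. E j)) t"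
    by (rule phi_measure_mono_AE)
  also have "\<dots> \<le> phi_measure M \<phi> (\<Union>j. A j) t + phi_measure M \<phi> (\<Union>j. E j) t"
    using A_sets E_sets t by (intro phi_measure_Un_le) auto
  also have "\<dots> \<le> (\<Sum>j. phi_measure M \<phi> (A j) t) + (\<Sum>j. phi_measure M \<phi> (E j) t)"
    using A_sets E_sets t by (intro add_mono phi_measure_UN_le) auto
  also have "\<dots> \<le> (\<Sum>j. ennreal (Cl * \<delta> ^ j)) + (\<Sum>j. ennreal (Cu * (c / (1 - \<theta>)) powr q0 * \<eta> ^ j))"
    by (intro add_mono suminf_le A_le E_le summableI)
  also have "\<dots> = ennreal (Cl / (1 - \<delta>) + Cu * (c / (1 - \<theta>)) powr q0 / (1 - \<eta>))"
    using \<delta> \<eta> Cl Cu_pos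
    by (simp add: suminf_ennreal_geometric ennreal_plus del: suminf_ennreal)
  finally show ?thesis unfolding t_def .
qed

lemma atomic_decomp_imp_WL_norm_le:
  assumes q: "ennreal pp < q" and "0 < c"
  shows "\<exists>D>0. \<forall>f a \<nu> r. (\<forall>n. f n \<in> borel_measurable M) \<longrightarrow> (a, \<nu>) \<in> atomic_decomps T M F \<phi> q c f \<longrightarrow> 0 < r \<longrightarrow>
    (SUP k. phi_measure M \<phi> (hit_set M (\<nu> k)) (2 powi k / r)) \<le> 1 \<longrightarrow> WL_norm M \<phi> (T f) \<le> ennreal (D * r)"
proof -
  \<comment> \<open>For q = \<infinity> any exponent above pp would do, by
    \<open>atom_chebyshev\<close>.\<close>
  define q0 where "q0 = (if q = \<infinity> then pp + 1 else enn2real q)"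
  have q0: "q \<noteq> \<infinity> \<Longrightarrow> q0 = enn2real q" "pp < q0"
  proof -
    show "pp < q0"
    proof (cases q rule: ennreal_cases)
      case (real x)
      then show ?thesis using q pp_pos by (simp add: q0_def ennreal_less_iff)
    qed (simp add: q0_def)
  qed (simp add: q0_def)
  have q_pos: "0 < q" using q by (rule le_less_trans[rotated]) simp
  define \<delta> :: real where "\<delta> = (1 / 2) powr pm"
  define \<theta> :: real where "\<theta> = 2 powr (- (q0 - pp) / (2 * q0))"
  define \<eta> :: real where "\<eta> = 2 powr (- (q0 - pp) / 2)"
  define C where "C = Cl / (1 - \<delta>) + Cu * (c / (1 - \<theta>)) powr q0 / (1 - \<eta>)"
  have "\<delta> < 1" using pm_pos powr_less_mono2[of pm "1/2" 1] by (simp add: \<delta>_def)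
  moreover have "\<eta> < 1" using q0 powr_less_mono[of _ 0 "2::real"] by (simp add: \<eta>_def)
  ultimately have "0 < C" using Cl Cu_pos unfolding C_def by (intro add_pos_nonneg) auto
  then obtain s where s: "0 < s" "s \<le> 1" "Cl * s powr pm * C \<le> 1" by (rule small_scale)
  have "WL_norm M \<phi> (T f) \<le> ennreal (2 / s * r)"
    if "\<forall>n. f n \<in> borel_measurable M" "(a, \<nu>) \<in> atomic_decomps T M F \<phi> q c f" "0 < r"
      "(SUP k. phi_measure M \<phi> (hit_set M (\<nu> k)) (2 powi k / r)) \<le> 1" for f a \<nu> r
  proof (rule WL_norm_le[OF _ that(3) s(1,2) \<open>0 < C\<close> s(3)])
    show "T f \<in> borel_measurable M" using that(1) by (intro T_measurable) simp
    fix \<alpha> :: real and k :: int assume \<alpha>: "2 powi k \<le> \<alpha>"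
    show "phi_measure M \<phi> {x \<in> space M. ennreal \<alpha> < T f x} (2 powi k / r) \<le> ennreal C"
      unfolding C_def using that(1)
      by (intro atomic_decomp_distribution[OF that(2) _ q_pos q0 \<open>0 < c\<close> that(3,4) \<alpha> \<delta>_def \<theta>_def \<eta>_def]) simp_all
  qed
  then show ?thesis using s by (intro exI[of _ "2 / s"]) auto
qed

end

section \<open>Bounded martingales as multiples of atoms\<close>

definition first_time :: "(nat \<Rightarrow> bool) \<Rightarrow> enat" where
  "first_time P = (if \<exists>n. P n then enat (LEAST n. P n) else \<infinity>)"

lemma first_time_le_iff: "first_time P \<le> enat n \<longleftrightarrow> (\<exists>m\<le>n. P m)"
  unfolding first_time_def by (auto intro: LeastI Least_le order_trans)

lemma less_first_time_iff: "enat n < first_time P \<longleftrightarrow> (\<forall>m\<le>n. \<not> P m)"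
  using first_time_le_iff[of P n] by (auto simp flip: not_le)

lemma le_first_time_iff: "enat n \<le> first_time P \<longleftrightarrow> (\<forall>m<n. \<not> P m)"
proof (cases n)
  case 0
  then show ?thesis by (simp add: zero_enat_def[symmetric])
next
  case (Suc k)
  have "enat (Suc k) \<le> first_time P \<longleftrightarrow> enat k < first_time P"
    by (simp add: Suc_ile_eq)
  then show ?thesis by (simp add: Suc less_first_time_iff less_Suc_eq_le)
qed

lemma first_time_less_infinity_iff: "first_time P < \<infinity> \<longleftrightarrow> (\<exists>n. P n \<and> (\<forall>m<n. \<not> P m))"
proof -
  have "(\<exists>n. P n) \<longleftrightarrow> (\<exists>n. P n \<and> (\<forall>m<n. \<not> P m))"
    using exists_least_iff[of P] .
  then show ?thesis unfolding first_time_def by auto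
qed

text \<open>The stopped sequence minus its initial value, written as a martingale transform. Where
  \<open>f 0\<close> vanishes it is the usual stopped sequence.\<close>

definition stopped :: "(nat \<Rightarrow> 'a \<Rightarrow> real) \<Rightarrow> ('a \<Rightarrow> enat) \<Rightarrow> nat \<Rightarrow> 'a \<Rightarrow> real" where
  "stopped f \<tau> n x = (\<Sum>m<n. of_bool (enat m < \<tau> x) * (f (Suc m) x - f m x))"

lemma stopped_finite:
  assumes "f 0 x = 0" "\<tau> x = enat j"
  shows "stopped f \<tau> n x = f (min n j) x"
proof (induction n)
  case (Suc n)
  then show ?case using assms by (cases "n < j") (auto simp: stopped_def min_def not_less)
qed (simp add: stopped_def assms)

lemma stopped_infinite:
  assumes "f 0 x = 0" "\<tau> x = \<infinity>"
  shows "stopped f \<tau> n x = f n x"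
  by (induction n) (simp_all add: stopped_def assms)

lemma ennreal_rpow_mono:
  assumes "0 < p" "0 \<le> y" "u \<le> ennreal y"
  shows "ennreal_rpow u p \<le> ennreal (y powr p)"
proof (cases u rule: ennreal_cases)
  case (real r)
  then show ?thesis using assms by (simp add: ennreal_rpow_def ennreal_leI powr_mono2)
next
  case top
  then show ?thesis using assms by (simp add: top_unique)
qed

context martingale_operator
begin

text \<open>A sequence stopped at j is constant from j on, so by \<open>N_stop\<close> its
  \<open>N n\<close> is at most \<open>N j\<close>, and j \<le> \<tau> falls under the
  hypothesis.\<close>

lemma N_stopped_le:
  assumes "f 0 x = 0" "\<And>n. enat n \<le> \<tau> x \<Longrightarrow> N n (\<lambda>i. f i x) \<le> \<alpha>"
  shows "N n (\<lambda>i. stopped f \<tau> i x) \<le> \<alpha>"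
proof (cases "\<tau> x")
  case (enat j)
  then have "(\<lambda>i. stopped f \<tau> i x) = (\<lambda>i. f (min i j) x)"
    using assms(1) by (auto simp: stopped_finite)
  then show ?thesis using N_stop[of n "\<lambda>i. f i x" j] assms(2)[of j] enat by simp
next
  case infinity
  then have "(\<lambda>i. stopped f \<tau> i x) = (\<lambda>i. f i x)"
    using assms(1) by (auto simp: stopped_infinite)
  then show ?thesis using assms(2)[of n] infinity by simp
qed

end

context musielak_orlicz_space
begin

lemma phi_integrable: "0 < t \<Longrightarrow> integrable M (\<lambda>x. \<phi> x t)"
  using phi_finite[of t] phi_measurable[of t] phi_nonneg[of _ t]
  by (intro integrableI_nonneg) auto

lemma phi_measure_eq_integral:
  assumes "0 < t" "E \<in> sets M"
  shows "phi_measure M \<phi> E t = ennreal (\<integral>x. indicator E x * \<phi> x t \<partial>M)"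
proof -
  have "integrable M (\<lambda>x. indicator E x * \<phi> x t)"
    using integrable_mult_indicator[OF assms(2) phi_integrable[OF assms(1)]] by simp
  then have "(\<integral>\<^sup>+x. ennreal (indicator E x * \<phi> x t) \<partial>M) = ennreal (\<integral>x. indicator E x * \<phi> x t \<partial>M)"
    using phi_nonneg[of _ t] assms by (intro nn_integral_eq_integral AE_I2) auto
  moreover have "(\<integral>\<^sup>+x. ennreal (indicator E x * \<phi> x t) \<partial>M) = phi_measure M \<phi> E t"
    unfolding phi_measure_def by (intro nn_integral_cong) (auto simp: indicator_def)
  ultimately show ?thesis by simp
qed

end

context martingale_operator_orlicz
begin

interpretation ce: sigma_finite_subalgebra M "F n" for n
  by (rule sigma_finite_subalgebra_F)

text \<open>A bounded square function does not bound g uniformly. Summing \<open>N_increment\<close>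
  gives a bound linear in n, enough for integrability; the uniform bound is the one in L^2, from
  \<open>N_L2\<close>.\<close>

lemma bounded_martingale_closed:
  assumes g: "martingale M F g" and g0: "AE x in M. g 0 x = 0"
    and bd: "AE x in M. \<forall>n. N n (\<lambda>i. g i x) \<le> C"
  shows "\<exists>a. integrable M a \<and> (\<forall>n. AE x in M. cond_seq M F a n x = g n x)"
proof (rule martingale_closed_if_L2_bounded[OF g])
  note [measurable] = martingale_measurable[OF g]
  show g_bd: "AE x in M. \<bar>g n x\<bar> \<le> 2 * C * real n" for n
    using g0 bd
  proof eventually_elim
    case (elim x)
    show ?case
    proof (induction n)
      case (Suc n)
      have "\<bar>g (Suc n) x - g n x\<bar> \<le> 2 * N (Suc n) (\<lambda>i. g i x)" by (rule N_increment)
      also have "\<dots> \<le> 2 * C" using elim(2) by simp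
      finally have "\<bar>g (Suc n) x - g n x\<bar> \<le> 2 * C" .
      then show ?case using Suc by (simp add: algebra_simps)
    qed (simp add: elim)
  qed
  have sq: "AE x in M. (N n (\<lambda>i. g i x))\<^sup>2 \<le> C\<^sup>2" for n
    using bd by eventually_elim (auto intro!: power_mono N_nonneg)
  show "(\<integral>x. (g n x)\<^sup>2 \<partial>M) \<le> C\<^sup>2" for n
    using N_L2
  proof
    assume *: "\<forall>n u. (u n)\<^sup>2 \<le> (N n u)\<^sup>2"
    have **: "AE x in M. (g n x)\<^sup>2 \<le> C\<^sup>2"
      using sq[of n]
    proof eventually_elim
      case (elim x)
      then show ?case using *[rule_format, of "\<lambda>i. g i x" n] by simp
    qed
    have "(\<integral>x. (g n x)\<^sup>2 \<partial>M) \<le> (\<integral>x. C\<^sup>2 \<partial>M)"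
      using ** by (intro integral_mono_AE integrable_AE_bounded[of _ "C\<^sup>2"]) auto
    then show ?thesis by (simp add: prob_space)
  next
    assume *: "\<forall>n u. (\<Sum>i<n. (u (Suc i) - u i)\<^sup>2) \<le> (N n u)\<^sup>2"
    let ?S = "\<lambda>x. \<Sum>i<n. (g (Suc i) x - g i x)\<^sup>2"
    have **: "AE x in M. ?S x \<le> C\<^sup>2"
      using sq[of n]
    proof eventually_elim
      case (elim x)
      then show ?case using *[rule_format, of "\<lambda>i. g i x" n] by simp
    qed
    have "(\<integral>x. (g n x)\<^sup>2 \<partial>M) = (\<integral>x. ?S x \<partial>M)"
      by (rule martingale_L2_eq_sum_increments[OF g g_bd g0])
    also have "\<dots> \<le> (\<integral>x. C\<^sup>2 \<partial>M)"
      using ** by (intro integral_mono_AE integrable_AE_bounded[of _ "C\<^sup>2"]) (auto simp: sum_nonneg)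
    finally show ?thesis by (simp add: prob_space)
  qed
qed

text \<open>The denominator \<phi>(B, t) cancels against the weight on the support B, so one sup
  bound controls the norm for every q and every t.\<close>

lemma L_phi_q_norm_le:
  assumes B: "B \<in> sets M" "emeasure M B \<noteq> 0" and g[measurable]: "g \<in> borel_measurable M"
    and le: "AE x in M. g x \<le> ennreal y" and supp: "AE x in M. x \<notin> B \<longrightarrow> g x = 0"
    and "0 < y" "0 < q"
  shows "L_phi_q_norm M \<phi> q B g \<le> ennreal y"
proof (cases "q = \<infinity>")
  case True
  then show ?thesis using le by (auto simp: L_phi_q_norm_def intro!: esssup_I)
next
  case False
  define q0 where "q0 = enn2real q"
  have q0: "0 < q0" using False \<open>0 < q\<close> by (cases q rule: ennreal_cases) (auto simp: q0_def)
  have "ennreal_rpow (1 / phi_measure M \<phi> B t * (\<integral>\<^sup>+x. ennreal_rpow (g x) q0 * ennreal (\<phi> x t) \<partial>M)) (1 / q0) \<le> ennreal y"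
    if t: "0 < t" for t
  proof -
    note [measurable] = phi_measurable[OF less_imp_le[OF t]] B(1)
    obtain p where p: "0 < p" "phi_measure M \<phi> B t = ennreal p"
      using phi_measure_finite[OF t, of B] phi_measure_pos[OF B(1) t B(2)]
      by (cases "phi_measure M \<phi> B t" rule: ennreal_cases) auto
    have "(\<integral>\<^sup>+x. ennreal_rpow (g x) q0 * ennreal (\<phi> x t) \<partial>M)
        \<le> (\<integral>\<^sup>+x. ennreal (y powr q0) * (ennreal (\<phi> x t) * indicator B x) \<partial>M)"
    proof (rule nn_integral_mono_AE)
      show "AE x in M. ennreal_rpow (g x) q0 * ennreal (\<phi> x t) \<le> ennreal (y powr q0) * (ennreal (\<phi> x t) * indicator B x)"
        using le supp
      proof eventually_elim
        case (elim x)
        show ?case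
        proof (cases "x \<in> B")
          case True
          then show ?thesis using elim ennreal_rpow_mono[OF q0 _ elim(1)] \<open>0 < y\<close> by (simp add: mult_right_mono)
        next
          case False
          then show ?thesis using elim by (simp add: ennreal_rpow_def)
        qed
      qed
    qed
    also have "\<dots> = ennreal (y powr q0) * ennreal p"
      unfolding p(2)[symmetric] phi_measure_def by (rule nn_integral_cmult) measurable
    finally have "1 / ennreal p * (\<integral>\<^sup>+x. ennreal_rpow (g x) q0 * ennreal (\<phi> x t) \<partial>M)
        \<le> 1 / ennreal p * (ennreal (y powr q0) * ennreal p)" by (rule mult_left_mono) simp
    also have "\<dots> = ennreal (y powr q0)"
      using p(1) divide_ennreal[of 1 p] by (simp flip: ennreal_mult)
    finally have "ennreal_rpow (1 / ennreal p * (\<integral>\<^sup>+x. ennreal_rpow (g x) q0 * ennreal (\<phi> x t) \<partial>M)) (1 / q0)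
        \<le> ennreal ((y powr q0) powr (1 / q0))"
      using q0 by (intro ennreal_rpow_mono) auto
    then show ?thesis unfolding p(2) using q0 \<open>0 < y\<close> by (simp add: powr_powr)
  qed
  then show ?thesis using False unfolding L_phi_q_norm_def q0_def by (auto intro!: SUP_least)
qed

text \<open>The atom is the closing function divided by m times the quasi-norm of the indicator of
  B. If B is null the coefficient is 0, g vanishes a.e., and the zero function serves.\<close>

lemma atom_of_bounded_martingale:
  assumes g: "martingale M F g" and \<nu>: "ext_stopping_time M F \<nu>" and "0 < m" "0 < q"
    and bd: "AE x in M. \<forall>n. N n (\<lambda>i. g i x) \<le> m"
    and vanish: "AE x in M. \<forall>n. enat n \<le> \<nu> x \<longrightarrow> g n x = 0"
  shows "\<exists>a. is_atom T M F \<phi> q a \<nu> \<and>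
    (\<forall>n. AE x in M. m * enn2real (L_phi_norm M \<phi> (indicator (hit_set M \<nu>))) * cond_seq M F a n x = g n x)"
proof -
  define B where "B = hit_set M \<nu>"
  have B: "B \<in> sets M" unfolding B_def using \<nu> subalgebra_F by (rule hit_set_sets)
  note [measurable] = martingale_measurable[OF g]
  have off_B: "AE x in M. x \<notin> B \<longrightarrow> (\<forall>n. g n x = 0)"
    using vanish AE_space by eventually_elim (auto simp: B_def hit_set_def)
  show ?thesis
  proof (cases "emeasure M B = 0")
    case True
    then have "AE x in M. x \<notin> B" using B by (intro AE_not_in) auto
    then have g0: "AE x in M. g n x = 0" for n using off_B by eventually_elim simp
    have "AE x in M. cond_seq M F (\<lambda>_. 0) n x = 0" for n
      unfolding cond_seq_def by (rule ce.real_cond_exp_F_meas) auto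
    moreover have "AE x in M. enat n \<le> \<nu> x \<longrightarrow> cond_seq M F (\<lambda>_. 0) n x = 0" for n
      using calculation[of n] by eventually_elim simp
    ultimately show ?thesis
      using g0 True \<nu> L_phi_norm_indicator_null[OF B True]
      by (intro exI[of _ "\<lambda>_. 0"]) (auto simp: is_atom_def B_def elim: eventually_mono)
  next
    case False
    obtain b where b: "0 < b" "L_phi_norm M \<phi> (indicator B) = ennreal b"
      using L_phi_norm_indicator_cases[OF B False] .
    have "AE x in M. g 0 x = 0"
      using vanish by eventually_elim (auto simp: zero_enat_def[symmetric])
    then obtain a0 where a0: "integrable M a0" "\<And>n. AE x in M. cond_seq M F a0 n x = g n x"
      using bounded_martingale_closed[OF g _ bd] by blast
    define a where "a x = a0 x / (m * b)" for x
    have a_int: "integrable M a" unfolding a_def using a0(1) by simp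
    have cond: "AE x in M. \<forall>n. cond_seq M F a n x = g n x / (m * b)"
      unfolding AE_all_countable
    proof
      fix n
      have "AE x in M. cond_seq M F a n x = cond_seq M F a0 n x / (m * b)"
        unfolding cond_seq_def a_def by (rule ce.real_cond_exp_cdiv[OF a0(1)])
      then show "AE x in M. cond_seq M F a n x = g n x / (m * b)"
        using a0(2)[of n] by eventually_elim simp
    qed
    have "AE x in M. T (cond_seq M F a) x \<le> ennreal (1 / b)"
      using cond bd
    proof eventually_elim
      case (elim x)
      show ?case
      proof (rule T_leI)
        fix n
        have "N n (\<lambda>i. cond_seq M F a i x) = N n (\<lambda>i. 1 / (m * b) * g i x)" using elim(1) by simp
        also have "\<dots> = 1 / (m * b) * N n (\<lambda>i. g i x)" unfolding N_scale using b \<open>0 < m\<close> by simp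
        also have "\<dots> \<le> 1 / (m * b) * m" using elim(2) b \<open>0 < m\<close> by (intro mult_left_mono) auto
        finally show "N n (\<lambda>i. cond_seq M F a i x) \<le> 1 / b" using \<open>0 < m\<close> by simp
      qed
    qed
    moreover have "AE x in M. x \<notin> B \<longrightarrow> T (cond_seq M F a) x = 0"
      using cond off_B by eventually_elim (auto intro!: T_eq_0)
    ultimately have "L_phi_q_norm M \<phi> q B (T (cond_seq M F a)) \<le> ennreal (1 / b)"
      using b \<open>0 < q\<close> B False by (intro L_phi_q_norm_le) auto
    moreover have "AE x in M. enat n \<le> \<nu> x \<longrightarrow> cond_seq M F a n x = 0" for n
      using cond vanish by eventually_elim simp
    ultimately have "is_atom T M F \<phi> q a \<nu>"
      using b a_int \<nu> by (simp add: is_atom_def B_def inverse_ennreal inverse_eq_divide)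
    moreover have "AE x in M. m * enn2real (L_phi_norm M \<phi> (indicator B)) * cond_seq M F a n x = g n x" for n
      using cond by eventually_elim (use b \<open>0 < m\<close> in simp)
    ultimately show ?thesis unfolding B_def by blast
  qed
qed

end

section \<open>From the weak Hardy space to atoms\<close>

lemma le_mult_Inf:
  fixes X :: ennreal
  assumes "0 < D" and le: "\<And>y. y \<in> S \<Longrightarrow> X \<le> ennreal D * y"
  shows "X \<le> ennreal D * Inf S"
proof -
  have inv: "ennreal (1 / D) * (ennreal D * y) = y" "ennreal D * (ennreal (1 / D) * y) = y" for y
    using \<open>0 < D\<close> by (simp_all flip: ennreal_mult mult.assoc)
  have "ennreal (1 / D) * X \<le> y" if "y \<in> S" for y
    using mult_left_mono[OF le[OF that], of "ennreal (1 / D)"] by (simp add: inv)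
  then have "ennreal (1 / D) * X \<le> Inf S" by (rule Inf_greatest)
  then have "ennreal D * (ennreal (1 / D) * X) \<le> ennreal D * Inf S" by (rule mult_left_mono) simp
  then show ?thesis by (simp add: inv)
qed

lemma has_sum_finite_sum:
  fixes u :: "'i \<Rightarrow> 'k \<Rightarrow> real"
  assumes "\<And>i. i \<in> I \<Longrightarrow> (u i has_sum s i) A"
  shows "((\<lambda>k. \<Sum>i\<in>I. u i k) has_sum (\<Sum>i\<in>I. s i)) A"
  using assms by (induction I rule: infinite_finite_induct) (auto intro!: has_sum_add)

text \<open>P switches from false to true at exactly one k, and only that term of the series is
  nonzero. \<open>low\<close> is asked only for d \<noteq> 0 because, where an increment of f
  vanishes, low levels need not have triggered an alarm.\<close>

lemma has_sum_telescope_threshold: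
  fixes P :: "int \<Rightarrow> bool" and d :: real
  assumes mono: "\<And>k. P k \<Longrightarrow> P (k + 1)" and low: "d \<noteq> 0 \<Longrightarrow> \<exists>k. \<not> P k" and high: "\<exists>k. P k"
  shows "((\<lambda>k. (of_bool (P (k + 1)) - of_bool (P k)) * d) has_sum d) UNIV"
proof (cases "d = 0")
  case False
  obtain k1 k2 where k: "\<not> P k1" "P k2" using low[OF False] high by auto
  have mono': "P l" if "P k" "k \<le> l" for k l
    using that(2,1) by (induction l rule: int_ge_induct) (auto intro: mono)
  have "k1 < k2" using k mono' by (meson not_less)
  \<comment> \<open>The least element is sought among naturals, counted from a place where P fails;
    the switch is at the predecessor.\<close>
  define j where "j = (LEAST j. P (k1 + int j))"
  have ex: "P (k1 + int (nat (k2 - k1)))" using k \<open>k1 < k2\<close> by simp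
  have j: "P (k1 + int j)" unfolding j_def by (rule LeastI[of "\<lambda>j. P (k1 + int j)", OF ex])
  have "j \<noteq> 0" using j k by (intro notI) simp
  then obtain i where i: "j = Suc i" by (cases j) auto
  have "\<not> P (k1 + int i)" using not_less_Least[of i "\<lambda>j. P (k1 + int j)"] i by (simp add: j_def)
  then obtain k0 where k0: "\<not> P k0" "P (k0 + 1)" using j i by (metis add.assoc add.commute of_nat_Suc)
  show ?thesis
  proof (rule has_sum_finite_neutralI[of "{k0}"])
    fix k assume "k \<in> UNIV - {k0}"
    then consider "k + 1 \<le> k0" | "k0 + 1 \<le> k" by force
    then have "P (k + 1) = P k"
    proof cases
      case 1
      then show ?thesis using k0(1) mono' by (metis mono)
    next
      case 2
      then show ?thesis using k0(2) mono' mono by blast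
    qed
    then show "(of_bool (P (k + 1)) - of_bool (P k)) * d = 0" by simp
  qed (use k0 in auto)
qed simp

locale weak_hardy = martingale_operator_orlicz T N M \<phi> pm pp Cl Cu F + regular_stochastic_basis M F R
  for T :: "(nat \<Rightarrow> 'a \<Rightarrow> real) \<Rightarrow> 'a \<Rightarrow> ennreal" and N and M :: "'a measure" and \<phi> pm pp Cl Cu F R +
  fixes K :: real
  assumes K_pos: "0 < K"
    and S_minus: "0 < t \<Longrightarrow> AE x in M. cond_phi M F \<phi> n x t \<le> K * cond_phi M F \<phi> (Suc n) x t"
begin

interpretation ce: sigma_finite_subalgebra M "F n" for n
  by (rule sigma_finite_subalgebra_F)

section \<open>Alarm times\<close>

definition level_set :: "(nat \<Rightarrow> 'a \<Rightarrow> real) \<Rightarrow> real \<Rightarrow> nat \<Rightarrow> 'a set" where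
  "level_set f \<alpha> n = {x \<in> space M. \<alpha> < N n (\<lambda>i. f i x)}"

text \<open>Built on fixed versions of the conditional probabilities: the alarm is exactly
  \<open>F n\<close>-measurable, so alarm times are genuine stopping times, while comparing
  different levels is possible a.e. only.\<close>

definition alarm :: "(nat \<Rightarrow> 'a \<Rightarrow> real) \<Rightarrow> real \<Rightarrow> 'a \<Rightarrow> nat \<Rightarrow> bool" where
  "alarm f \<alpha> x n \<longleftrightarrow> 1 / R \<le> real_cond_exp M (F n) (indicator (level_set f \<alpha> (Suc n))) x"

text \<open>
  Stopping one step before the level \<open>\<alpha>\<close> is exceeded: as soon as this has conditional probability at
  least \<open>1 / R\<close>, which by regularity happens whenever it has positive conditional probability.
\<close>

definition alarm_time :: "(nat \<Rightarrow> 'a \<Rightarrow> real) \<Rightarrow> real \<Rightarrow> 'a \<Rightarrow> enat" where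
  "alarm_time f \<alpha> x = first_time (alarm f \<alpha> x)"

lemma alarm_sets: "{x \<in> space M. alarm f \<alpha> x n} \<in> sets (F n)"
  unfolding alarm_def space_F[of n, symmetric] by measurable

lemma alarm_time_stopping: "ext_stopping_time M F (alarm_time f \<alpha>)"
  unfolding ext_stopping_time_def stopping_time_def
proof
  fix t :: enat
  show "Measurable.pred (case t of enat n \<Rightarrow> F n | \<infinity> \<Rightarrow> M) (\<lambda>x. alarm_time f \<alpha> x \<le> t)"
  proof (cases t)
    case (enat n)
    have "{x \<in> space M. alarm_time f \<alpha> x \<le> enat n} = (\<Union>m\<in>{..n}. {x \<in> space M. alarm f \<alpha> x m})"
      by (auto simp: alarm_time_def first_time_le_iff)
    also have "\<dots> \<in> sets (F n)"
      using sets_F_mono[OF _ alarm_sets] by (intro sets.finite_UN) auto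
    finally show ?thesis using enat by (simp add: pred_def space_F)
  qed simp
qed

context
  fixes f
  assumes f: "martingale M F f"
begin

lemma N_martingale_measurable: "(\<lambda>x. N n (\<lambda>i. f i x)) \<in> borel_measurable (F n)"
  by (rule N_measurable) (rule measurable_F_mono[OF _ martingale_adapted[OF f]])

lemma level_set_sets: "level_set f \<alpha> n \<in> sets (F n)"
  unfolding level_set_def space_F[of n, symmetric] using N_martingale_measurable by measurable

lemma level_set_sets_M[measurable]: "level_set f \<alpha> n \<in> sets M"
  using level_set_sets by (rule sets_F_subset)

lemma integrable_level_set: "integrable M (indicator (level_set f \<alpha> n) :: 'a \<Rightarrow> real)"
  by (rule integrable_AE_bounded[of _ 1]) (simp_all add: indicator_def)

text \<open>No alarm at k means R times the conditional probability of the level set at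
  \<open>Suc k\<close> is below 1; this dominates its indicator, which must then be 0. As the alarm
  looks one step ahead, the bound includes the alarm time itself. Time 0 is covered by
  \<open>N_0\<close>.\<close>

lemma N_le_before_alarm:
  assumes f0: "AE x in M. f 0 x = 0" and "0 < \<alpha>"
  shows "AE x in M. \<forall>n. enat n \<le> alarm_time f \<alpha> x \<longrightarrow> N n (\<lambda>i. f i x) \<le> \<alpha>"
proof -
  have "AE x in M. \<forall>n. indicator (level_set f \<alpha> (Suc n)) x
      \<le> R * real_cond_exp M (F n) (indicator (level_set f \<alpha> (Suc n))) x"
    unfolding AE_all_countable by (intro allI indicator_le_cond_prob level_set_sets)
  then show ?thesis using f0 AE_space
  proof eventually_elim
    case (elim x)
    show ?case
    proof (intro allI impI)
      fix n assume n: "enat n \<le> alarm_time f \<alpha> x"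
      show "N n (\<lambda>i. f i x) \<le> \<alpha>"
      proof (cases n)
        case 0
        then show ?thesis using N_0[of "\<lambda>i. f i x"] elim(2) \<open>0 < \<alpha>\<close> by simp
      next
        case (Suc k)
        have "\<not> alarm f \<alpha> x k" using n Suc by (simp add: alarm_time_def le_first_time_iff)
        then have "R * real_cond_exp M (F k) (indicator (level_set f \<alpha> (Suc k))) x < 1"
          using R_pos by (simp add: alarm_def field_simps)
        then have "indicator (level_set f \<alpha> (Suc k)) x < (1 :: real)"
          using elim(1)[rule_format, of k] by linarith
        then have "x \<notin> level_set f \<alpha> (Suc k)" by (auto simp: indicator_def split: if_splits)
        then show ?thesis using elim(3) Suc by (simp add: level_set_def not_less)
      qed
    qed
  qed
qed

text \<open>With L the level set: on D replace \<phi> by its conditional expectation given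
  \<open>F n\<close>, insert R P(L | \<open>F n\<close>) \<ge> 1, and unfold that probability to the
  indicator of L. Since D \<inter> L belongs only to \<open>F (Suc n)\<close>, S^- is needed to pass
  to the next conditional expectation before returning to \<phi>.\<close>

lemma phi_measure_alarm_step:
  assumes D: "D \<in> sets (F n)" and alarm: "\<And>x. x \<in> D \<Longrightarrow> alarm f \<alpha> x n" and "0 < t"
  shows "phi_measure M \<phi> D t \<le> ennreal (R * K) * phi_measure M \<phi> (D \<inter> level_set f \<alpha> (Suc n)) t"
proof -
  let ?L = "level_set f \<alpha> (Suc n)"
  let ?h = "\<lambda>x. \<phi> x t"
  let ?H = "\<lambda>n. real_cond_exp M (F n) ?h"
  have D_M[measurable]: "D \<in> sets M" using D by (rule sets_F_subset)
  note [measurable] = phi_measurable[OF less_imp_le[OF \<open>0 < t\<close>]] level_set_sets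
  have ind_D[measurable]: "indicator D \<in> borel_measurable (F n)" using D by simp
  have h: "integrable M ?h" by (rule phi_integrable[OF \<open>0 < t\<close>])
  have intE: "integrable M (\<lambda>x. indicator E x * g x)" if "E \<in> sets M" "integrable M g" for E and g :: "'a \<Rightarrow> real"
    using integrable_mult_indicator[OF that] by simp
  have H: "integrable M (?H i)" for i by (rule ce.real_cond_exp_int(1)[OF h])
  have DH: "integrable M (\<lambda>x. indicator D x * ?H n x)" by (rule intE[OF D_M H])
  have DHL: "integrable M (\<lambda>x. (indicator D x * ?H n x) * indicator ?L x)"
    using intE[OF _ DH, of ?L] by (simp add: mult.commute)
  have DL: "indicator D x * indicator ?L x = (indicator (D \<inter> ?L) x :: real)" for x
    by (simp add: indicator_inter_arith)
  have H_nonneg: "AE x in M. 0 \<le> ?H n x"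
    by (rule ce.real_cond_exp_pos) (use phi_nonneg \<open>0 < t\<close> in auto)
  have "(\<integral>x. indicator D x * ?h x \<partial>M) = (\<integral>x. indicator D x * ?H n x \<partial>M)"
    by (rule ce.real_cond_exp_intg(2)[symmetric]) (use intE[OF D_M h] in simp_all)
  also have "\<dots> \<le> (\<integral>x. R * ((indicator D x * ?H n x) * real_cond_exp M (F n) (indicator ?L) x) \<partial>M)"
  proof (rule integral_mono_AE[OF DH])
    show "integrable M (\<lambda>x. R * ((indicator D x * ?H n x) * real_cond_exp M (F n) (indicator ?L) x))"
      by (intro integrable_mult_right ce.real_cond_exp_intg(1) DHL) measurable
    show "AE x in M. indicator D x * ?H n x \<le> R * ((indicator D x * ?H n x) * real_cond_exp M (F n) (indicator ?L) x)"
      using H_nonneg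
    proof eventually_elim
      case (elim x)
      show ?case
      proof (cases "x \<in> D")
        case True
        then have "1 \<le> R * real_cond_exp M (F n) (indicator ?L) x"
          using alarm[OF True] R_pos by (simp add: alarm_def field_simps)
        then have "1 * ?H n x \<le> (R * real_cond_exp M (F n) (indicator ?L) x) * ?H n x"
          using elim by (rule mult_right_mono)
        then show ?thesis using True by (simp add: mult_ac)
      qed simp
    qed
  qed
  also have "\<dots> = R * (\<integral>x. (indicator D x * ?H n x) * indicator ?L x \<partial>M)"
  proof -
    have "(\<integral>x. (indicator D x * ?H n x) * real_cond_exp M (F n) (indicator ?L) x \<partial>M)
        = (\<integral>x. (indicator D x * ?H n x) * indicator ?L x \<partial>M)"
      by (rule ce.real_cond_exp_intg(2)[OF DHL]) measurable
    then show ?thesis by simp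
  qed
  also have "\<dots> \<le> R * (K * (\<integral>x. indicator (D \<inter> ?L) x * ?H (Suc n) x \<partial>M))"
  proof -
    have "(\<integral>x. (indicator D x * ?H n x) * indicator ?L x \<partial>M) \<le> (\<integral>x. K * (indicator (D \<inter> ?L) x * ?H (Suc n) x) \<partial>M)"
    proof (rule integral_mono_AE[OF DHL])
      show "integrable M (\<lambda>x. K * (indicator (D \<inter> ?L) x * ?H (Suc n) x))"
        by (intro integrable_mult_right intE H) simp
      show "AE x in M. (indicator D x * ?H n x) * indicator ?L x \<le> K * (indicator (D \<inter> ?L) x * ?H (Suc n) x)"
        using S_minus[OF \<open>0 < t\<close>, of n] unfolding cond_phi_def
        by eventually_elim (simp add: indicator_def)
    qed
    then show ?thesis using R_pos by simp
  qed
  also have "(\<integral>x. indicator (D \<inter> ?L) x * ?H (Suc n) x \<partial>M) = (\<integral>x. indicator (D \<inter> ?L) x * ?h x \<partial>M)"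
  proof (rule ce.real_cond_exp_intg(2))
    have "D \<inter> ?L \<in> sets (F (Suc n))"
      using sets_F_mono[OF _ D, of "Suc n"] level_set_sets by auto
    then show "indicator (D \<inter> ?L) \<in> borel_measurable (F (Suc n))" by simp
  qed (use intE[OF _ h, of "D \<inter> ?L"] in simp_all)
  finally have le: "(\<integral>x. indicator D x * ?h x \<partial>M) \<le> R * K * (\<integral>x. indicator (D \<inter> ?L) x * ?h x \<partial>M)"
    by (simp add: mult.assoc)
  have "phi_measure M \<phi> D t = ennreal (\<integral>x. indicator D x * ?h x \<partial>M)"
    by (rule phi_measure_eq_integral[OF \<open>0 < t\<close> D_M])
  also have "\<dots> \<le> ennreal (R * K * (\<integral>x. indicator (D \<inter> ?L) x * ?h x \<partial>M))"
    by (rule ennreal_leI[OF le])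
  also have "\<dots> = ennreal (R * K) * phi_measure M \<phi> (D \<inter> ?L) t"
    using R_pos K_pos phi_measure_eq_integral[OF \<open>0 < t\<close>, of "D \<inter> ?L"] by (simp add: ennreal_mult')
  finally show ?thesis .
qed

text \<open>The one-step estimate is applied to the sets of first alarm at n. They are disjoint, so
  their parts in the level sets add up without loss inside the set where T f exceeds
  \<alpha>.\<close>

lemma phi_measure_alarm_time_le:
  assumes "0 < \<alpha>" "0 < t"
  shows "phi_measure M \<phi> (hit_set M (alarm_time f \<alpha>)) t
    \<le> ennreal (R * K) * phi_measure M \<phi> {x \<in> space M. ennreal \<alpha> < T f x} t"
proof -
  define D where "D n = {x \<in> space M. alarm f \<alpha> x n \<and> (\<forall>m<n. \<not> alarm f \<alpha> x m)}" for n
  have D: "D n \<in> sets (F n)" for n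
  proof -
    have "D n = {x \<in> space M. alarm f \<alpha> x n} - (\<Union>m\<in>{..<n}. {x \<in> space M. alarm f \<alpha> x m})"
      by (auto simp: D_def)
    also have "\<dots> \<in> sets (F n)"
      using sets_F_mono[OF _ alarm_sets] by (intro sets.Diff sets.finite_UN alarm_sets) auto
    finally show ?thesis .
  qed
  have D_M: "D n \<in> sets M" for n using D by (rule sets_F_subset)
  let ?A = "\<lambda>n. D n \<inter> level_set f \<alpha> (Suc n)"
  have disj: "disjoint_family ?A"
    unfolding disjoint_family_on_def D_def by (auto dest: linorder_neqE_nat)
  have A: "?A n \<in> sets M" for n using D_M by simp
  have "hit_set M (alarm_time f \<alpha>) = (\<Union>n. D n)"
    unfolding hit_set_def D_def alarm_time_def first_time_less_infinity_iff by auto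
  then have "phi_measure M \<phi> (hit_set M (alarm_time f \<alpha>)) t \<le> (\<Sum>n. phi_measure M \<phi> (D n) t)"
    using phi_measure_UN_le[of t D] D_M \<open>0 < t\<close> by simp
  also have "\<dots> \<le> (\<Sum>n. ennreal (R * K) * phi_measure M \<phi> (?A n) t)"
    by (intro suminf_le summableI phi_measure_alarm_step D \<open>0 < t\<close>) (simp add: D_def)
  also have "\<dots> = ennreal (R * K) * (\<Sum>n. phi_measure M \<phi> (?A n) t)" by simp
  also have "(\<Sum>n. phi_measure M \<phi> (?A n) t) = phi_measure M \<phi> (\<Union>n. ?A n) t"
    using suminf_emeasure[of ?A "density M (\<lambda>x. ennreal (\<phi> x t))"] disj A \<open>0 < t\<close>
    by (simp add: phi_measure_eq_emeasure image_subset_iff)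
  also have "\<dots> \<le> phi_measure M \<phi> {x \<in> space M. ennreal \<alpha> < T f x} t"
    using \<open>0 < \<alpha>\<close> by (intro phi_measure_mono_AE AE_I2) (auto simp: level_set_def less_T_iff)
  finally show ?thesis by (simp add: mult_left_mono)
qed

lemma alarm_antimono:
  assumes "\<alpha> \<le> \<beta>"
  shows "AE x in M. alarm f \<beta> x n \<longrightarrow> alarm f \<alpha> x n"
proof -
  have "AE x in M. real_cond_exp M (F n) (indicator (level_set f \<beta> (Suc n))) x
      \<le> real_cond_exp M (F n) (indicator (level_set f \<alpha> (Suc n))) x"
    using assms by (intro ce.real_cond_exp_mono integrable_level_set AE_I2) (auto simp: indicator_def level_set_def)
  then show ?thesis by eventually_elim (auto simp: alarm_def)
qed

text \<open>Conditional Markov inequality. It shows that at a given point and up to a given time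
  high levels raise no alarm, so alarm times tend to \<infinity> with the level.\<close>

lemma alarm_markov:
  assumes "0 < \<alpha>"
  shows "AE x in M. alarm f \<alpha> x n \<longrightarrow> \<alpha> \<le> R * real_cond_exp M (F n) (\<lambda>x. N (Suc n) (\<lambda>i. f i x)) x"
proof -
  let ?N = "\<lambda>x. N (Suc n) (\<lambda>i. f i x)"
  have [measurable]: "?N \<in> borel_measurable M" by (rule measurable_F_M[OF N_martingale_measurable])
  have int: "integrable M ?N"
  proof (rule Bochner_Integration.integrable_bound)
    show "integrable M (\<lambda>x. \<Sum>i\<le>Suc n. 2 * \<bar>f i x\<bar>)"
      using martingale_integrable[OF f] by (intro Bochner_Integration.integrable_sum integrable_mult_right integrable_abs)
    show "AE x in M. norm (?N x) \<le> norm (\<Sum>i\<le>Suc n. 2 * \<bar>f i x\<bar>)"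
    proof (rule AE_I2)
      fix x
      show "norm (?N x) \<le> norm (\<Sum>i\<le>Suc n. 2 * \<bar>f i x\<bar>)"
        unfolding real_norm_def abs_of_nonneg[OF N_nonneg] by (rule order_trans[OF N_le_sum abs_ge_self])
    qed
  qed simp
  have "AE x in M. real_cond_exp M (F n) (indicator (level_set f \<alpha> (Suc n))) x \<le> real_cond_exp M (F n) (\<lambda>x. ?N x / \<alpha>) x"
    using assms int N_nonneg
    by (intro ce.real_cond_exp_mono integrable_level_set AE_I2) (auto simp: indicator_def level_set_def)
  then show ?thesis using ce.real_cond_exp_cdiv[OF int, where c = \<alpha> and n = n]
  proof eventually_elim
    case (elim x)
    then have "real_cond_exp M (F n) (indicator (level_set f \<alpha> (Suc n))) x \<le> real_cond_exp M (F n) ?N x / \<alpha>" by simp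
    then have "1 / R \<le> real_cond_exp M (F n) ?N x / \<alpha>" if "alarm f \<alpha> x n"
      using that by (simp add: alarm_def)
    then show ?case using assms R_pos by (simp add: field_simps)
  qed
qed

lemma stopped_martingale_diff:
  assumes "ext_stopping_time M F \<sigma>" "ext_stopping_time M F \<tau>"
  shows "martingale M F (\<lambda>n x. stopped f \<tau> n x - stopped f \<sigma> n x)"
proof -
  have pred: "Measurable.pred (F m) (\<lambda>x. enat m < \<tau> x)" if "ext_stopping_time M F \<tau>" for \<tau> m
    using stopping_timeD2[OF that[unfolded ext_stopping_time_def], of "enat m"] by simp
  have "martingale M F (\<lambda>n x. \<Sum>m<n. (of_bool (enat m < \<tau> x) - of_bool (enat m < \<sigma> x)) * (f (Suc m) x - f m x))"
  proof (rule martingale_transform[OF f])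
    fix m
    show "(\<lambda>x. of_bool (enat m < \<tau> x) - of_bool (enat m < \<sigma> x) :: real) \<in> borel_measurable (F m)"
      using pred[OF assms(1), of m] pred[OF assms(2), of m] unfolding of_bool_def by measurable
  qed simp
  then show ?thesis by (simp add: stopped_def left_diff_distrib sum_subtractf)
qed

lemma atomic_decomposition:
  assumes f0: "AE x in M. f 0 x = 0" and "0 < c" "0 < q"
  shows "\<exists>a \<nu>. (a, \<nu>) \<in> atomic_decomps T M F \<phi> q c f \<and>
    (\<forall>k t. 0 < t \<longrightarrow> phi_measure M \<phi> (hit_set M (\<nu> k)) t
      \<le> ennreal (R * K) * phi_measure M \<phi> {x \<in> space M. ennreal (c / 3 * 2 powi k) < T f x} t)"
proof -
  \<comment> \<open>Chosen so that \<rho>(k) + \<rho>(k + 1) = c 2^k.\<close>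
  define \<rho> where "\<rho> k = c / 3 * 2 powi k" for k :: int
  have \<rho>: "0 < \<rho> k" "\<rho> (k + 1) = 2 * \<rho> k" for k using \<open>0 < c\<close> by (simp_all add: \<rho>_def power_int_add)
  define \<nu> where "\<nu> k = alarm_time f (\<rho> k)" for k
  have \<nu>_stop: "ext_stopping_time M F (\<nu> k)" for k unfolding \<nu>_def by (rule alarm_time_stopping)
  define g where "g k n x = stopped f (\<nu> (k + 1)) n x - stopped f (\<nu> k) n x" for k n x
  have g: "martingale M F (g k)" for k
    unfolding g_def by (intro stopped_martingale_diff \<nu>_stop)
  have alarm_mono: "AE x in M. \<forall>k n. alarm f (\<rho> (k + 1)) x n \<longrightarrow> alarm f (\<rho> k) x n"
    unfolding AE_all_countable using \<rho> by (intro allI alarm_antimono) (simp add: less_imp_le)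
  have N_le: "AE x in M. \<forall>k n. enat n \<le> \<nu> k x \<longrightarrow> N n (\<lambda>i. f i x) \<le> \<rho> k"
    unfolding \<nu>_def by (rule AE_all_countable[THEN iffD2], intro allI N_le_before_alarm f0 \<rho>)
  have atom: "\<exists>a. is_atom T M F \<phi> q a (\<nu> k) \<and>
      (\<forall>n. AE x in M. c * 2 powi k * enn2real (L_phi_norm M \<phi> (indicator (hit_set M (\<nu> k)))) * cond_seq M F a n x = g k n x)" for k
  proof (rule atom_of_bounded_martingale[OF g \<nu>_stop _ \<open>0 < q\<close>])
    show "0 < c * 2 powi k" using \<open>0 < c\<close> by simp
    show "AE x in M. \<forall>n. N n (\<lambda>i. g k i x) \<le> c * 2 powi k"
      using N_le f0
    proof eventually_elim
      case (elim x)
      have stop: "N n (\<lambda>i. stopped f (\<nu> l) i x) \<le> \<rho> l" for l n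
        using elim by (intro N_stopped_le) auto
      have "N n (\<lambda>i. g k i x) \<le> \<rho> (k + 1) + \<rho> k" for n
        unfolding g_def by (intro order_trans[OF N_diff] add_mono stop)
      also have "\<rho> (k + 1) + \<rho> k = c * 2 powi k" unfolding \<rho>(2) by (simp add: \<rho>_def)
      finally show ?case by blast
    qed
    show "AE x in M. \<forall>n. enat n \<le> \<nu> k x \<longrightarrow> g k n x = 0"
      using alarm_mono
    proof eventually_elim
      case (elim x)
      show ?case
      proof (intro allI impI)
        fix n assume n: "enat n \<le> \<nu> k x"
        \<comment> \<open>Alarms at the higher level are alarms at the lower one, so \<nu>(k) \<le>
          \<nu>(k + 1); before \<nu>(k) both stopped sequences have the same increments.\<close>
        have "enat m < \<nu> k x \<and> enat m < \<nu> (k + 1) x" if "m < n" for m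
          using n that elim unfolding \<nu>_def alarm_time_def less_first_time_iff le_first_time_iff by fastforce
        then show "g k n x = 0" by (simp add: g_def stopped_def)
      qed
    qed
  qed
  then obtain a where a: "\<And>k. is_atom T M F \<phi> q (a k) (\<nu> k)"
    "\<And>k n. AE x in M. c * 2 powi k * enn2real (L_phi_norm M \<phi> (indicator (hit_set M (\<nu> k)))) * cond_seq M F (a k) n x = g k n x"
    by metis
  have a_eq: "AE x in M. \<forall>k n. atom_coeff M \<phi> c \<nu> k * cond_seq M F (a k) n x = g k n x"
    unfolding AE_all_countable atom_coeff_def using a(2) by simp
  have markov: "AE x in M. \<forall>k n. alarm f (\<rho> k) x n \<longrightarrow> \<rho> k \<le> R * real_cond_exp M (F n) (\<lambda>x. N (Suc n) (\<lambda>i. f i x)) x"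
    unfolding AE_all_countable by (intro allI alarm_markov \<rho>)
  have "AE x in M. \<forall>n. ((\<lambda>k. atom_coeff M \<phi> c \<nu> k * cond_seq M F (a k) n x) has_sum f n x) UNIV"
    using a_eq markov alarm_mono N_le f0
  proof eventually_elim
    case (elim x)
    \<comment> \<open>Each nonzero increment of f belongs to exactly one k, the one with
      \<open>\<nu> k x \<le> enat m < \<nu> (k + 1) x\<close>; hence the unconditional
      convergence.\<close>
    have step: "((\<lambda>k. (of_bool (enat m < \<nu> (k + 1) x) - of_bool (enat m < \<nu> k x)) * (f (Suc m) x - f m x))
        has_sum (f (Suc m) x - f m x)) UNIV" for m
    proof (rule has_sum_telescope_threshold)
      show "enat m < \<nu> (k + 1) x" if "enat m < \<nu> k x" for k
        using that elim(3) unfolding \<nu>_def alarm_time_def less_first_time_iff by blast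
      have small: "\<exists>k. 2 powi k < (e :: real)" if e: "0 < e" for e
      proof -
        obtain n where "(1 / 2) ^ n < e" using real_arch_pow_inv[OF e, of "1/2"] by auto
        then show ?thesis by (intro exI[of _ "- int n"]) (simp add: power_int_minus power_one_over inverse_eq_divide)
      qed
      show "\<exists>k. \<not> enat m < \<nu> k x" if d: "f (Suc m) x - f m x \<noteq> 0"
      proof -
        \<comment> \<open>Without an alarm up to time m the increment would be at most 2 \<rho>(k),
          which fails for very negative k.\<close>
        obtain k :: int where "2 powi k < \<bar>f (Suc m) x - f m x\<bar> / (2 * (c / 3))"
          using small[of "\<bar>f (Suc m) x - f m x\<bar> / (2 * (c / 3))"] d \<open>0 < c\<close> by auto
        then have k: "2 * \<rho> k < \<bar>f (Suc m) x - f m x\<bar>"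
          using \<open>0 < c\<close> by (simp add: \<rho>_def field_simps)
        have "\<not> enat (Suc m) \<le> \<nu> k x"
        proof
          assume "enat (Suc m) \<le> \<nu> k x"
          then have "N (Suc m) (\<lambda>i. f i x) \<le> \<rho> k" using elim(4) by blast
          then show False using N_increment[of "\<lambda>i. f i x" m] k by linarith
        qed
        then show ?thesis by (auto simp: Suc_ile_eq)
      qed
      show "\<exists>k. enat m < \<nu> k x"
      proof -
        \<comment> \<open>Dominates the finitely many conditional expectations that the Markov bound
          involves up to time m; a level above R Z then raises no alarm.\<close>
        define Z where "Z = (\<Sum>j\<le>m. \<bar>real_cond_exp M (F j) (\<lambda>x. N (Suc j) (\<lambda>i. f i x)) x\<bar>)"
        have Z: "\<bar>real_cond_exp M (F j) (\<lambda>x. N (Suc j) (\<lambda>i. f i x)) x\<bar> \<le> Z" if "j \<le> m" for j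
          unfolding Z_def using that by (intro member_le_sum) auto
        have "0 \<le> Z" unfolding Z_def by (rule sum_nonneg) simp
        obtain n where n: "R * Z / (c / 3) < 2 ^ n" using real_arch_pow[of 2 "R * Z / (c / 3)"] by auto
        then have k: "R * Z < \<rho> (int n)" using \<open>0 < c\<close> by (simp add: \<rho>_def field_simps)
        have "\<not> alarm f (\<rho> (int n)) x j" if "j \<le> m" for j
        proof
          assume "alarm f (\<rho> (int n)) x j"
          then have "\<rho> (int n) \<le> R * real_cond_exp M (F j) (\<lambda>x. N (Suc j) (\<lambda>i. f i x)) x" using elim(2) by blast
          also have "\<dots> \<le> R * Z" using Z[OF that] R_pos by (intro mult_left_mono) auto
          finally show False using k by simp
        qed
        then show ?thesis unfolding \<nu>_def alarm_time_def less_first_time_iff by blast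
      qed
    qed
    show ?case
    proof
      fix n
      have "((\<lambda>k. \<Sum>m<n. (of_bool (enat m < \<nu> (k + 1) x) - of_bool (enat m < \<nu> k x)) * (f (Suc m) x - f m x))
          has_sum (\<Sum>m<n. f (Suc m) x - f m x)) UNIV"
        by (intro has_sum_finite_sum step)
      moreover have "(\<Sum>m<n. f (Suc m) x - f m x) = f n x"
        using sum_lessThan_telescope[of "\<lambda>m. f m x" n] elim(5) by simp
      ultimately show "((\<lambda>k. atom_coeff M \<phi> c \<nu> k * cond_seq M F (a k) n x) has_sum f n x) UNIV"
        using elim(1) by (simp add: g_def stopped_def left_diff_distrib sum_subtractf)
    qed
  qed
  then have "(a, \<nu>) \<in> atomic_decomps T M F \<phi> q c f"
    using a(1) by (simp add: atomic_decomps_def AE_all_countable)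
  moreover have "phi_measure M \<phi> (hit_set M (\<nu> k)) t
      \<le> ennreal (R * K) * phi_measure M \<phi> {x \<in> space M. ennreal (\<rho> k) < T f x} t" if "0 < t" for k t
    unfolding \<nu>_def using \<rho> that by (intro phi_measure_alarm_time_le) auto
  ultimately show ?thesis unfolding \<rho>_def by blast
qed

end

section \<open>Comparison of the quasi-norms\<close>

lemma WL_norm_ge_atomic_norm:
  assumes "0 < c" "0 < q"
  shows "\<exists>D>0. \<forall>f\<in>null_martingales M F. atomic_decomps T M F \<phi> q c f \<noteq> {} \<and>
    WH_at_norm T M F \<phi> q c f \<le> ennreal D * WH_norm T M \<phi> f"
proof -
  have "0 < R * K" using R_pos K_pos by simp
  then obtain s where s: "0 < s" "s \<le> 1" "Cl * s powr pm * (R * K) \<le> 1" by (rule small_scale)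
  \<comment> \<open>Makes 2^k / (D r) equal to s times (c/3 * 2^k) / r: the factor 3/c matches the
    levels, and s absorbs R K.\<close>
  define D where "D = 3 / (c * s)"
  have D: "0 < D" using s \<open>0 < c\<close> by (simp add: D_def)
  have "atomic_decomps T M F \<phi> q c f \<noteq> {} \<and> WH_at_norm T M F \<phi> q c f \<le> ennreal D * WH_norm T M \<phi> f"
    if f: "f \<in> null_martingales M F" for f
  proof -
    have mart: "martingale M F f" and f0: "AE x in M. f 0 x = 0"
      using f by (auto simp: null_martingales_def)
    let ?E = "\<lambda>\<alpha>. {x \<in> space M. ennreal \<alpha> < T f x}"
    have E[measurable]: "?E \<alpha> \<in> sets M" for \<alpha>
      using T_measurable[of f M] martingale_measurable[OF mart] by measurable
    obtain a \<nu> where dec: "(a, \<nu>) \<in> atomic_decomps T M F \<phi> q c f"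
      and le: "\<And>k t. 0 < t \<Longrightarrow> phi_measure M \<phi> (hit_set M (\<nu> k)) t
        \<le> ennreal (R * K) * phi_measure M \<phi> (?E (c / 3 * 2 powi k)) t"
      using atomic_decomposition[OF mart f0 assms] by blast
    have "WH_at_norm T M F \<phi> q c f \<le> ennreal D * ennreal r"
      if r: "0 < r" "(SUP \<alpha>\<in>{0<..}. phi_measure M \<phi> (?E \<alpha>) (\<alpha> / r)) \<le> 1" for r
    proof -
      have "phi_measure M \<phi> (hit_set M (\<nu> k)) (2 powi k / (D * r)) \<le> 1" for k
      proof -
        let ?\<alpha> = "c / 3 * 2 powi k"
        have \<alpha>: "0 < ?\<alpha>" using \<open>0 < c\<close> by simp
        have "phi_measure M \<phi> (hit_set M (\<nu> k)) (2 powi k / (D * r))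
            \<le> ennreal (R * K) * phi_measure M \<phi> (?E ?\<alpha>) (2 powi k / (D * r))"
          using D r by (intro le) simp
        also have "\<dots> = ennreal (R * K) * phi_measure M \<phi> (?E ?\<alpha>) (s * (?\<alpha> / r))"
          using s \<open>0 < c\<close> r by (simp add: D_def field_simps)
        also have "\<dots> \<le> ennreal (R * K) * (ennreal (Cl * s powr pm) * phi_measure M \<phi> (?E ?\<alpha>) (?\<alpha> / r))"
          using \<alpha> r s by (intro mult_left_mono phi_measure_lower E) auto
        also have "\<dots> \<le> ennreal (R * K) * (ennreal (Cl * s powr pm) * 1)"
          using \<alpha> by (intro mult_left_mono order_trans[OF SUP_upper r(2)]) auto
        also have "\<dots> = ennreal (Cl * s powr pm * (R * K))"
          using R_pos K_pos Cl by (simp add: mult.commute flip: ennreal_mult)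
        also have "\<dots> \<le> 1" using s by simp
        finally show ?thesis .
      qed
      then have "(SUP k. phi_measure M \<phi> (hit_set M (\<nu> k)) (2 powi k / (D * r))) \<le> 1"
        by (intro SUP_least)
      then have "Inf {ennreal r | r. 0 < r \<and> (SUP k. phi_measure M \<phi> (hit_set M (\<nu> k)) (2 powi k / r)) \<le> 1} \<le> ennreal (D * r)"
        using D r by (intro Inf_lower CollectI exI[of _ "D * r"]) simp
      moreover have "WH_at_norm T M F \<phi> q c f
          \<le> Inf {ennreal r | r. 0 < r \<and> (SUP k. phi_measure M \<phi> (hit_set M (\<nu> k)) (2 powi k / r)) \<le> 1}"
        unfolding WH_at_norm_def by (rule INF_lower2[OF dec]) simp
      ultimately show ?thesis using D r by (simp add: ennreal_mult)
    qed
    then have "WH_at_norm T M F \<phi> q c f \<le> ennreal D * WH_norm T M \<phi> f"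
      unfolding WH_norm_def WL_norm_def by (intro le_mult_Inf[OF D]) auto
    then show ?thesis using dec by auto
  qed
  then show ?thesis using D by blast
qed

lemma weak_hardy_eq_atomic:
  assumes "0 < c" "ennreal pp < q"
  shows "WH T M F \<phi> = WH_at T M F \<phi> q c \<and>
    equivalent_on (WH T M F \<phi>) (WH_norm T M \<phi>) (WH_at_norm T M F \<phi> q c)"
proof -
  have q: "0 < q" using assms(2) by (rule le_less_trans[rotated]) simp
  obtain D1 where D1: "0 < D1" and le1': "\<And>f a \<nu> r. (\<forall>n. f n \<in> borel_measurable M) \<Longrightarrow>
      (a, \<nu>) \<in> atomic_decomps T M F \<phi> q c f \<Longrightarrow> 0 < r \<Longrightarrow>
      (SUP k. phi_measure M \<phi> (hit_set M (\<nu> k)) (2 powi k / r)) \<le> 1 \<Longrightarrow> WL_norm M \<phi> (T f) \<le> ennreal (D1 * r)"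
    using atomic_decomp_imp_WL_norm_le[OF assms(2,1)] by blast
  obtain D2 where D2: "0 < D2" and le2: "\<And>f. f \<in> null_martingales M F \<Longrightarrow>
      atomic_decomps T M F \<phi> q c f \<noteq> {} \<and> WH_at_norm T M F \<phi> q c f \<le> ennreal D2 * WH_norm T M \<phi> f"
    using WL_norm_ge_atomic_norm[OF assms(1) q] by blast
  \<comment> \<open>Two nested infima, over decompositions and over scalars, are handled by
    \<open>le_mult_Inf\<close>; without any decomposition the right side is \<infinity>.\<close>
  have le1: "WH_norm T M \<phi> f \<le> ennreal D1 * WH_at_norm T M F \<phi> q c f" if "f \<in> null_martingales M F" for f
  proof -
    have meas: "\<forall>n. f n \<in> borel_measurable M"
      using that martingale_measurable by (auto simp: null_martingales_def)
    show ?thesis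
      unfolding WH_at_norm_def WH_norm_def
    proof (rule le_mult_Inf[OF D1])
      fix y assume "y \<in> (\<lambda>(a, \<nu>). Inf {ennreal r | r. 0 < r \<and>
        (SUP k. phi_measure M \<phi> (hit_set M (\<nu> k)) (2 powi k / r)) \<le> 1}) ` atomic_decomps T M F \<phi> q c f"
      then obtain a \<nu> where dec: "(a, \<nu>) \<in> atomic_decomps T M F \<phi> q c f"
        and y: "y = Inf {ennreal r | r. 0 < r \<and> (SUP k. phi_measure M \<phi> (hit_set M (\<nu> k)) (2 powi k / r)) \<le> 1}"
        by auto
      show "WL_norm M \<phi> (T f) \<le> ennreal D1 * y"
        unfolding y
      proof (rule le_mult_Inf[OF D1])
        fix z assume "z \<in> {ennreal r | r. 0 < r \<and> (SUP k. phi_measure M \<phi> (hit_set M (\<nu> k)) (2 powi k / r)) \<le> 1}"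
        then obtain r where r: "z = ennreal r" "0 < r" "(SUP k. phi_measure M \<phi> (hit_set M (\<nu> k)) (2 powi k / r)) \<le> 1"
          by auto
        have "WL_norm M \<phi> (T f) \<le> ennreal (D1 * r)" by (rule le1'[OF meas dec r(2,3)])
        then show "WL_norm M \<phi> (T f) \<le> ennreal D1 * z" using D1 r by (simp add: ennreal_mult)
      qed
    qed
  qed
  have "WH_norm T M \<phi> f < \<infinity> \<longleftrightarrow> atomic_decomps T M F \<phi> q c f \<noteq> {} \<and> WH_at_norm T M F \<phi> q c f < \<infinity>"
    if f: "f \<in> null_martingales M F" for f
  proof
    assume "WH_norm T M \<phi> f < \<infinity>"
    then have "ennreal D2 * WH_norm T M \<phi> f < \<infinity>" by (simp add: ennreal_mult_less_top)
    then show "atomic_decomps T M F \<phi> q c f \<noteq> {} \<and> WH_at_norm T M F \<phi> q c f < \<infinity>"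
      using le2[OF f] by (auto intro: le_less_trans)
  next
    assume "atomic_decomps T M F \<phi> q c f \<noteq> {} \<and> WH_at_norm T M F \<phi> q c f < \<infinity>"
    then have "ennreal D1 * WH_at_norm T M F \<phi> q c f < \<infinity>" by (simp add: ennreal_mult_less_top)
    then show "WH_norm T M \<phi> f < \<infinity>" using le1[OF f] by (rule le_less_trans[rotated])
  qed
  then have "WH T M F \<phi> = WH_at T M F \<phi> q c" by (auto simp: WH_def WH_at_def)
  moreover have "ennreal (1 / D1) * WH_norm T M \<phi> f \<le> WH_at_norm T M F \<phi> q c f"
    if "f \<in> null_martingales M F" for f
    using mult_left_mono[OF le1[OF that], of "ennreal (1 / D1)"] D1
    by (simp flip: ennreal_mult mult.assoc)
  ultimately show ?thesis
    unfolding equivalent_on_def using D1 D2 le2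
    by (intro conjI exI[of _ "1 / D1"] exI[of _ D2]) (auto simp: WH_def)
qed

end

theorem theorem3p5:
  fixes M :: "'a measure" and F :: "nat \<Rightarrow> 'a measure"
    and \<phi> :: "'a \<Rightarrow> real \<Rightarrow> real" and pm pp c :: real and q :: ennreal
  assumes "prob_space M"
    and "filtration (space M) F"
    and "\<And>n. subalgebra M (F n)"
    and "musielak_orlicz M \<phi>"
    and "\<And>t. 0 < t \<Longrightarrow> (\<integral>\<^sup>+x. ennreal (\<phi> x t) \<partial>M) < \<infinity>"
    and "S_minus M F \<phi>"
    and "0 < pm" and "uniformly_lower_type M \<phi> pm"
    and "0 < pp" and "uniformly_upper_type M \<phi> pp"
    and "max (ennreal pp) 1 < q"
    and "regular_basis M F"
    and "0 < c"
  shows "(WH square_fun M F \<phi> = WH_at square_fun M F \<phi> q c \<and>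
          equivalent_on (WH square_fun M F \<phi>)
            (WH_norm square_fun M \<phi>) (WH_at_norm square_fun M F \<phi> q c)) \<and>
         (WH maximal_fun M F \<phi> = WH_at maximal_fun M F \<phi> q c \<and>
          equivalent_on (WH maximal_fun M F \<phi>)
            (WH_norm maximal_fun M \<phi>) (WH_at_norm maximal_fun M F \<phi> q c))"
proof -
  obtain C1 where C1: "0 < C1"
    "\<And>x t s. x \<in> space M \<Longrightarrow> 0 \<le> t \<Longrightarrow> 0 < s \<Longrightarrow> s < 1 \<Longrightarrow> \<phi> x (s * t) \<le> C1 * s powr pm * \<phi> x t"
    using assms(8) unfolding uniformly_lower_type_def by auto
  obtain C2 where C2: "0 < C2"
    "\<And>x t s. x \<in> space M \<Longrightarrow> 0 \<le> t \<Longrightarrow> 1 \<le> s \<Longrightarrow> \<phi> x (s * t) \<le> C2 * s powr pp * \<phi> x t"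
    using assms(10) unfolding uniformly_upper_type_def by auto
  obtain K where K: "0 < K"
    "\<And>n t. 1 \<le> n \<Longrightarrow> 0 < t \<Longrightarrow> AE x in M. 1 / K * cond_phi M F \<phi> (n - 1) x t \<le> cond_phi M F \<phi> n x t"
    using assms(6) unfolding S_minus_def by auto
  obtain R where R: "0 < R"
    "\<And>f n. martingale M F f \<Longrightarrow> (\<And>n. AE x in M. 0 \<le> f n x) \<Longrightarrow> 1 \<le> n \<Longrightarrow>
      AE x in M. f n x \<le> R * f (n - 1) x"
    using assms(12) unfolding regular_basis_def by metis
  have nonneg: "x \<in> space M \<Longrightarrow> 0 \<le> t \<Longrightarrow> 0 \<le> \<phi> x t" for x t
    using assms(4) by (auto simp: musielak_orlicz_def)
  \<comment> \<open>The maximum with 1 extends the lower type inequality from s < 1 to s =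
    1.\<close>
  interpret musielak_orlicz_space M \<phi> pm pp "max 1 C1" C2
  proof (intro musielak_orlicz_space.intro musielak_orlicz_space_axioms.intro assms(1,4,5,7,9) C2)
    show "\<phi> x (s * t) \<le> max 1 C1 * s powr pm * \<phi> x t"
      if "x \<in> space M" "0 \<le> t" "0 < s" "s \<le> 1" for x t s
    proof (cases "s = 1")
      case True
      then show ?thesis using mult_right_mono[of 1 "max 1 C1" "\<phi> x t"] nonneg[OF that(1,2)] by simp
    next
      case False
      then have "\<phi> x (s * t) \<le> C1 * s powr pm * \<phi> x t" using C1(2) that by simp
      also have "\<dots> \<le> max 1 C1 * s powr pm * \<phi> x t"
        using nonneg[OF that(1,2)] by (intro mult_right_mono) auto
      finally show ?thesis .
    qed
  qed auto
  interpret regular_stochastic_basis M F R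
  proof (intro regular_stochastic_basis.intro stochastic_basis.intro stochastic_basis_axioms.intro
      regular_stochastic_basis_axioms.intro assms(1-3) R(1))
    show "AE x in M. f (Suc n) x \<le> R * f n x"
      if "martingale M F f" "\<And>n. AE x in M. 0 \<le> f n x" for f n
      using R(2)[OF that, of "Suc n"] by simp
  qed
  have K': "AE x in M. cond_phi M F \<phi> n x t \<le> K * cond_phi M F \<phi> (Suc n) x t" if "0 < t" for n t
    using K(2)[of "Suc n", OF _ that] by (auto elim!: eventually_mono simp: field_simps K(1))
  have q: "ennreal pp < q" using assms(11) by simp
  interpret S: martingale_operator "square_fun :: (nat \<Rightarrow> 'a \<Rightarrow> real) \<Rightarrow> _" "\<lambda>n u. L2_set (\<lambda>i. u (Suc i) - u i) {..<n}"
    by (rule martingale_operator_square_fun)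
  interpret S: weak_hardy square_fun "\<lambda>n u. L2_set (\<lambda>i. u (Suc i) - u i) {..<n}" M \<phi> pm pp "max 1 C1" C2 F R K
    by unfold_locales (use K(1) K' in auto)
  interpret m: martingale_operator "maximal_fun :: (nat \<Rightarrow> 'a \<Rightarrow> real) \<Rightarrow> _" "\<lambda>n u. Max ((\<lambda>i. \<bar>u i\<bar>) ` {..n})"
    by (rule martingale_operator_maximal_fun)
  interpret m: weak_hardy maximal_fun "\<lambda>n u. Max ((\<lambda>i. \<bar>u i\<bar>) ` {..n})" M \<phi> pm pp "max 1 C1" C2 F R K
    by unfold_locales (use K(1) K' in auto)
  show ?thesis
    using S.weak_hardy_eq_atomic[OF assms(13) q] m.weak_hardy_eq_atomic[OF assms(13) q] by (rule conjI)
qed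

end
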